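(* Let $S$ be either $\mathbb{S}^2_+$ or $\mathbb{H}^2_+$, let $j\ge 2$, and let $\Gamma\subset S$ be a $C^j$ oval of length $l$. Then the associated billiard map $T_\Gamma:\mathcal{C}\to\mathcal{C}$ on the open cylinder $\mathcal{C}=\mathbb{R}/l\mathbb{Z}\times(0,\pi)$ is a reversible, conservative, Twist, $C^{j-1}$-diffeomorphism.
   Context: Surfaces: $\mathbb{S}^2_+=\{(x,y,z)\in\mathbb{R}^3: z=\sqrt{1-x^2-y^2},\ z>0\}$ is the open hemisphere of the unit sphere with the metric induced by the usual inner product $\langle\cdot,\cdot\rangle$ of $\mathbb{R}^3$; $\mathbb{H}^2_+=\{(x,y,z): z=\sqrt{1+x^2+y^2}\}\subset\mathbb{R}^{2,1}$ is the hyperbolic plane with the metric induced by the Lorentzian inner product $\langle\langle X,Y\rangle\rangle=x_1y_1+x_2y_2-x_3y_3$. $S$ is oriented so that the projection to the $(x,y)$-plane preserves orientation. Oval: a regular, simple, closed, oriented curve $\Gamma\subset S$ of class $C^j$, $j\ge2$, with strictly positive geodesic curvature. It is parameterized by arclength $s\in\mathbb{R}/l\mathbb{Z}$, $l$ being its length; $\eta(s)$ is the unit normal tangent to $S$ such that $\{\Gamma'(s),\eta(s)\}$ is a positively oriented orthonormal basis of $T_{\Gamma(s)}S$ (so $\eta$ points into the region $\Omega$ bounded by $\Gamma$). An oval is geodesically strictly convex: every geodesic tangent to $\Gamma$ meets $\Gamma$ in only one point. Billiard map: for $(s_0,\psi_0)\in\mathcal{C}$, the geodesic of $S$ starting at $\Gamma(s_0)$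 with initial unit direction $\cos\psi_0\,\Gamma'(s_0)+\sin\psi_0\,\eta(s_0)$ runs inside $\Omega$ until it meets $\Gamma$ again, at a point $\Gamma(s_1)$. There it is reflected elastically (equal angles with the tangent line), and $\psi_1\in(0,\pi)$ is the angle between $\Gamma'(s_1)$ and the direction of motion immediately after reflection. Then $T_\Gamma(s_0,\psi_0)=(s_1,\psi_1)$. Reversible: $T_\Gamma$ is invertible and $I\circ T_\Gamma^{-1}=T_\Gamma\circ I$, where $I(s,\psi)=(s,\pi-\psi)$. Conservative: $T_\Gamma$ preserves the measure $d\mu=\sin\psi\,ds\,d\psi$ on $\mathcal{C}$. Twist: writing $T_\Gamma(s_0,\psi_0)=(s_1(s_0,\psi_0),\psi_1(s_0,\psi_0))$, one has $\frac{\partial s_1}{\partial\psi_0}>0$ everywhere on $\mathcal{C}$. *)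

theory Defs
  imports "HOL-Analysis.Analysis" "HOL-Library.Real_Mod"
begin

section \<open>The two surfaces\<close>

datatype surface = Hemisphere | Hyperbolic_Plane

fun points :: "surface \<Rightarrow> (real ^ 3) set" where
  "points Hemisphere = {X. X $ 3 = sqrt (1 - (X $ 1)\<^sup>2 - (X $ 2)\<^sup>2) \<and> 0 < X $ 3}"
| "points Hyperbolic_Plane = {X. X $ 3 = sqrt (1 + (X $ 1)\<^sup>2 + (X $ 2)\<^sup>2)}"

text \<open>The ambient bilinear form: the Euclidean inner product of \<open>\<real>\<^sup>3\<close> for the
  hemisphere, the Lorentzian one for the hyperbolic plane.  It restricts to a
  Riemannian metric on each surface.\<close>

fun form :: "surface \<Rightarrow> real ^ 3 \<Rightarrow> real ^ 3 \<Rightarrow> real" where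
  "form Hemisphere X Y = X \<bullet> Y"
| "form Hyperbolic_Plane X Y = X $ 1 * Y $ 1 + X $ 2 * Y $ 2 - X $ 3 * Y $ 3"

text \<open>Both surfaces are open pieces of a level set of \<open>\<lambda>X. form S X X\<close> (with value \<open>1\<close>,
  respectively \<open>-1\<close>), so the tangent plane at \<open>X\<close> is the \<open>form\<close>-orthogonal complement
  of \<open>X\<close>, and \<open>tangential S X\<close> is the orthogonal projection onto it.\<close>

definition tangent_plane :: "surface \<Rightarrow> real ^ 3 \<Rightarrow> (real ^ 3) set" where
  "tangent_plane S X = {v. form S X v = 0}"

definition tangential :: "surface \<Rightarrow> real ^ 3 \<Rightarrow> real ^ 3 \<Rightarrow> real ^ 3" where
  "tangential S X a = a - (form S X a / form S X X) *\<^sub>R X"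

text \<open>A geodesic is a curve in the surface whose covariant acceleration, that is, the
  tangential part of its second derivative, vanishes.\<close>

definition geodesic_on :: "surface \<Rightarrow> real set \<Rightarrow> (real \<Rightarrow> real ^ 3) \<Rightarrow> bool" where
  "geodesic_on S J \<gamma> \<longleftrightarrow> \<gamma> ` J \<subseteq> points S \<and>
     (\<exists>v. \<forall>t\<in>J. (\<gamma> has_vector_derivative v t) (at t within J) \<and>
        (\<exists>a. (v has_vector_derivative a) (at t within J) \<and> tangential S (\<gamma> t) a = 0))"

section \<open>Maps of class \<open>C\<^sup>k\<close>\<close>

text \<open>To be used for open \<open>U\<close> and finite-dimensional domains, where it says that all
  iterated directional derivatives up to order \<open>k\<close> exist and are continuous.\<close>

primrec Ck_on ::
  "nat \<Rightarrow> 'a::real_normed_vector set \<Rightarrow> ('a \<Rightarrow> 'b::real_normed_vector) \<Rightarrow> bool" where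
  "Ck_on 0 U f \<longleftrightarrow> continuous_on U f"
| "Ck_on (Suc k) U f \<longleftrightarrow> (\<forall>x\<in>U. f differentiable (at x)) \<and>
     (\<forall>v. Ck_on k U (\<lambda>x. frechet_derivative f (at x) v))"

section \<open>Ovals\<close>

text \<open>A closed curve of length \<open>l\<close>, parameterized by arclength on \<open>\<real>/l\<int>\<close>, is an
  \<open>l\<close>-periodic function on \<open>\<real>\<close>.\<close>

abbreviation velocity :: "(real \<Rightarrow> real ^ 3) \<Rightarrow> real \<Rightarrow> real ^ 3" where
  "velocity \<Gamma> s \<equiv> vector_derivative \<Gamma> (at s)"

text \<open>The last condition of the next definition says that \<open>{\<Gamma>'(s), \<eta>}\<close> is positively
  oriented: the projection to the \<open>(x,y)\<close>-plane preserves orientation.\<close>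

definition unit_normal :: "surface \<Rightarrow> (real \<Rightarrow> real ^ 3) \<Rightarrow> real \<Rightarrow> real ^ 3" where
  "unit_normal S \<Gamma> s = (THE \<eta>. \<eta> \<in> tangent_plane S (\<Gamma> s) \<and> form S \<eta> \<eta> = 1 \<and>
     form S (velocity \<Gamma> s) \<eta> = 0 \<and>
     0 < velocity \<Gamma> s $ 1 * \<eta> $ 2 - velocity \<Gamma> s $ 2 * \<eta> $ 1)"

definition geodesic_curvature :: "surface \<Rightarrow> (real \<Rightarrow> real ^ 3) \<Rightarrow> real \<Rightarrow> real" where
  "geodesic_curvature S \<Gamma> s =
     form S (tangential S (\<Gamma> s) (vector_derivative (velocity \<Gamma>) (at s))) (unit_normal S \<Gamma> s)"

definition oval :: "surface \<Rightarrow> nat \<Rightarrow> real \<Rightarrow> (real \<Rightarrow> real ^ 3) \<Rightarrow> bool" where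
  "oval S j l \<Gamma> \<longleftrightarrow> 0 < l \<and> range \<Gamma> \<subseteq> points S \<and> Ck_on j UNIV \<Gamma> \<and>
     (\<forall>s. \<Gamma> (s + l) = \<Gamma> s) \<and> inj_on \<Gamma> {0..<l} \<and>
     (\<forall>s. form S (velocity \<Gamma> s) (velocity \<Gamma> s) = 1) \<and>
     (\<forall>s. 0 < geodesic_curvature S \<Gamma> s)"

text \<open>The region bounded by \<open>\<Gamma>\<close> is the union of the relatively compact components of
  the complement of \<open>\<Gamma>\<close> in the surface.  (Boundedness in \<open>\<real>\<^sup>3\<close> would not do, since the
  whole hemisphere is bounded.)\<close>

definition region :: "surface \<Rightarrow> (real \<Rightarrow> real ^ 3) \<Rightarrow> (real ^ 3) set" where
  "region S \<Gamma> = {X \<in> points S - range \<Gamma>.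
     \<exists>K. compact K \<and> K \<subseteq> points S \<and> connected_component_set (points S - range \<Gamma>) X \<subseteq> K}"

section \<open>The phase cylinder\<close>

text \<open>The circle \<open>\<real>/l\<int>\<close> is represented by \<open>{0..<l}\<close>, with quotient map \<open>\<lambda>s. s rmod l\<close>.
  As the subspace topology of \<open>{0..<l}\<close> is not that of the circle, smoothness on the
  cylinder is expressed below through the covering \<open>cyl_proj l\<close> of the cylinder by the
  strip, whose local inverses are the charts of the cylinder.\<close>

definition cylinder :: "real \<Rightarrow> (real \<times> real) set" where
  "cylinder l = {0..<l} \<times> {0<..<pi}"

definition strip :: "(real \<times> real) set" where
  "strip = UNIV \<times> {0<..<pi}"

definition cyl_proj :: "real \<Rightarrow> real \<times> real \<Rightarrow> real \<times> real" where
  "cyl_proj l = (\<lambda>(s, \<psi>). (s rmod l, \<psi>))"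

text \<open>\<open>F\<close> below is \<open>T\<close> written in local coordinates.\<close>

definition cyl_Ck :: "nat \<Rightarrow> real \<Rightarrow> (real \<times> real \<Rightarrow> real \<times> real) \<Rightarrow> bool" where
  "cyl_Ck k l T \<longleftrightarrow> T \<in> cylinder l \<rightarrow> cylinder l \<and>
     (\<forall>p\<in>strip. \<exists>U F. open U \<and> p \<in> U \<and> U \<subseteq> strip \<and> Ck_on k U F \<and>
        (\<forall>q\<in>U. F q \<in> strip \<and> cyl_proj l (F q) = T (cyl_proj l q)))"

definition cyl_diffeomorphism :: "nat \<Rightarrow> real \<Rightarrow> (real \<times> real \<Rightarrow> real \<times> real) \<Rightarrow> bool" where
  "cyl_diffeomorphism k l T \<longleftrightarrow> bij_betw T (cylinder l) (cylinder l) \<and>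
     cyl_Ck k l T \<and> cyl_Ck k l (inv_into (cylinder l) T)"

definition angle_reversal :: "real \<times> real \<Rightarrow> real \<times> real" where
  "angle_reversal = (\<lambda>(s, \<psi>). (s, pi - \<psi>))"

definition reversible :: "real \<Rightarrow> (real \<times> real \<Rightarrow> real \<times> real) \<Rightarrow> bool" where
  "reversible l T \<longleftrightarrow> bij_betw T (cylinder l) (cylinder l) \<and>
     (\<forall>p\<in>cylinder l. angle_reversal (inv_into (cylinder l) T p) = T (angle_reversal p))"

definition cyl_measure :: "real \<Rightarrow> (real \<times> real) measure" where
  "cyl_measure l = density (restrict_space lborel (cylinder l)) (\<lambda>(s, \<psi>). ennreal (sin \<psi>))"

definition conservative :: "real \<Rightarrow> (real \<times> real \<Rightarrow> real \<times> real) \<Rightarrow> bool" where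
  "conservative l T \<longleftrightarrow> T \<in> measurable (cyl_measure l) (cyl_measure l) \<and>
     distr (cyl_measure l) (cyl_measure l) T = cyl_measure l"

text \<open>In the next definition \<open>\<sigma>\<close> is a real-valued representative of \<open>\<psi> \<mapsto> s\<^sub>1(s\<^sub>0, \<psi>)\<close>
  near \<open>\<psi>\<^sub>0\<close>.  Differentiability makes it continuous at \<open>\<psi>\<^sub>0\<close>, hence near \<open>\<psi>\<^sub>0\<close> it is
  determined up to a constant multiple of \<open>l\<close>, and \<open>d\<close> is unambiguous.\<close>

definition twist :: "real \<Rightarrow> (real \<times> real \<Rightarrow> real \<times> real) \<Rightarrow> bool" where
  "twist l T \<longleftrightarrow> (\<forall>(s\<^sub>0, \<psi>\<^sub>0)\<in>cylinder l. \<exists>\<sigma> d.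
     (\<forall>\<^sub>F \<psi> in nhds \<psi>\<^sub>0. \<sigma> \<psi> rmod l = fst (T (s\<^sub>0, \<psi>))) \<and>
     (\<sigma> has_real_derivative d) (at \<psi>\<^sub>0) \<and> 0 < d)"

section \<open>The billiard map\<close>

text \<open>Elastic reflection of a tangent vector at \<open>\<Gamma>(s)\<close>.\<close>

definition reflect :: "surface \<Rightarrow> (real \<Rightarrow> real ^ 3) \<Rightarrow> real \<Rightarrow> real ^ 3 \<Rightarrow> real ^ 3" where
  "reflect S \<Gamma> s v = v - (2 * form S v (unit_normal S \<Gamma> s)) *\<^sub>R unit_normal S \<Gamma> s"

text \<open>The trajectory \<open>\<gamma>\<close> leaves \<open>\<Gamma>(s\<^sub>0)\<close> at time \<open>0\<close> and hits \<open>\<Gamma>\<close> again at time \<open>\<tau>\<close>.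
  Since all vectors involved have unit length, \<open>\<psi>\<^sub>1\<close> is the angle between \<open>\<Gamma>'(s\<^sub>1)\<close> and
  the velocity immediately after the reflection.\<close>

definition billiard_step ::
  "surface \<Rightarrow> (real \<Rightarrow> real ^ 3) \<Rightarrow> real \<times> real \<Rightarrow> real \<times> real \<Rightarrow> bool" where
  "billiard_step S \<Gamma> = (\<lambda>(s\<^sub>0, \<psi>\<^sub>0) (s\<^sub>1, \<psi>\<^sub>1). \<exists>\<tau> > 0. \<exists>\<gamma>.
     geodesic_on S {0..\<tau>} \<gamma> \<and>
     \<gamma> 0 = \<Gamma> s\<^sub>0 \<and>
     vector_derivative \<gamma> (at 0 within {0..\<tau>}) =
       cos \<psi>\<^sub>0 *\<^sub>R velocity \<Gamma> s\<^sub>0 + sin \<psi>\<^sub>0 *\<^sub>R unit_normal S \<Gamma> s\<^sub>0 \<and>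
     (\<forall>t\<in>{0<..<\<tau>}. \<gamma> t \<in> region S \<Gamma>) \<and>
     \<gamma> \<tau> = \<Gamma> s\<^sub>1 \<and>
     \<psi>\<^sub>1 = arccos (form S (velocity \<Gamma> s\<^sub>1)
             (reflect S \<Gamma> s\<^sub>1 (vector_derivative \<gamma> (at \<tau> within {0..\<tau>})))))"

definition billiard_map ::
  "surface \<Rightarrow> real \<Rightarrow> (real \<Rightarrow> real ^ 3) \<Rightarrow> real \<times> real \<Rightarrow> real \<times> real" where
  "billiard_map S l \<Gamma> p = (THE q. q \<in> cylinder l \<and> billiard_step S \<Gamma> p q)"

end

theory Submission
  imports Defs
begin

text \<open>The central projection from the origin to the plane \<open>z = 1\<close> maps geodesics to straight lines and
  preserves the sign of the curvature.  The projected curve is simple with positive curvature, so by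
  Hopf's argument its tangent turns exactly once and it is strictly convex; hence
  \<open>g(s, t) = det (\<Gamma> s, \<Gamma>' s, \<Gamma> t) > 0\<close> whenever \<open>\<Gamma> s \<noteq> \<Gamma> t\<close>.  With \<open>h(s, t) = \<langle>\<Gamma>' s, \<Gamma> t\<rangle>\<close>, the angle
  at \<open>\<Gamma> s\<close> of the geodesic to \<open>\<Gamma> t\<close> is \<open>\<alpha>(s, t) = arccot (h(s, t) / g(s, t))\<close>, of class \<open>C\<^sup>j\<^sup>-\<^sup>1\<close>, and
  \<open>\<partial>\<alpha>/\<partial>t = g(t, s) / (g\<^sup>2 + h\<^sup>2) > 0\<close>.  So \<open>(s, t) \<mapsto> (s, \<alpha>(s, t))\<close> is a diffeomorphism onto the strip, and
  the billiard map is \<open>(s, \<alpha>(s, t)) \<mapsto> (t, pi - \<alpha>(t, s))\<close>.  Diffeomorphism, reversibility and twist are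
  immediate.  In the coordinates \<open>(s, t)\<close> the measure \<open>sin \<psi> ds d\<psi>\<close> has the density
  \<open>g(s, t) g(t, s) / (g\<^sup>2 + h\<^sup>2)\<^sup>3\<^sup>/\<^sup>2\<close>, which is symmetric since
  \<open>g\<^sup>2 + h\<^sup>2 = \<plusminus>(1 - \<langle>\<Gamma> s, \<Gamma> t\<rangle>\<^sup>2)\<close>; this is conservation.\<close>

section \<open>Calculus of \<open>C\<^sup>k\<close> maps\<close>

text \<open>The map is given by a definite description over geodesics inside the bounded region, so
  it comes with no formula. The relation \<open>bounce\<close>, which involves only \<open>g\<close>
  and \<open>h\<close>, closes the gap: on the cylinder a billiard step is the same as a bounce. A
  bounce read backwards is again a bounce, and this one symmetry gives bijectivity and the inverse I
  T I with I = \<open>angle_reversal\<close>, so smoothness has to be proved for T alone, on its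
  lift \<open>next_bounce\<close> to the strip. The hard step leads from positive curvature, a local
  condition, to \<open>g\<close> > 0, a global one; there the simplicity of the curve enters. The
  order j - 1 is the smoothness of \<open>\<Gamma>'\<close>, which occurs in \<open>g\<close> and
  \<open>h\<close>; it is at least 1, as inverting \<open>\<alpha>\<close> in \<open>t\<close>
  requires. The region is reached through convexity: a point strictly on the inner side of all
  tangents lies in it. For conservation, Fubini reduces the change of variables to one integral for
  each \<open>s\<close>, and exchanging the two integrals exchanges \<open>s\<close> and
  \<open>t\<close>. Keeping the sign of the form as a factor \<open>curv S\<close> lets one
  computation serve both surfaces.\<close>

lemma Ck_on_imp_continuous_on: "Ck_on k U f \<Longrightarrow> continuous_on U f"
  by (cases k) (auto intro!: continuous_at_imp_continuous_on differentiable_imp_continuous_within)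

lemma Ck_on_SucD: "Ck_on (Suc k) U f \<Longrightarrow> Ck_on k U f"
proof (induction k arbitrary: f)
  case 0
  then show ?case using Ck_on_imp_continuous_on by fastforce
next
  case (Suc k)
  then show ?case by (metis Ck_on.simps(2))
qed

lemma Ck_on_le: "Ck_on m U f \<Longrightarrow> k \<le> m \<Longrightarrow> Ck_on k U f"
  by (induction m) (auto simp: le_Suc_eq dest: Ck_on_SucD simp del: Ck_on.simps)

lemma Ck_on_subset: "Ck_on k U f \<Longrightarrow> V \<subseteq> U \<Longrightarrow> Ck_on k V f"
  by (induction k arbitrary: f) (auto intro: continuous_on_subset)

text \<open>\<open>Ck_on\<close> takes derivatives in the whole space; the openness of
  \<open>U\<close> makes them depend on the values on \<open>U\<close> alone.\<close>

lemma Ck_on_cong: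
  assumes "open U" "\<And>x. x \<in> U \<Longrightarrow> f x = g x" "Ck_on k U f"
  shows "Ck_on k U g"
  using assms(2,3)
proof (induction k arbitrary: f g)
  case 0
  then show ?case by (simp cong: continuous_on_cong)
next
  case (Suc k)
  have d: "(g has_derivative frechet_derivative f (at x)) (at x)" if "x \<in> U" for x
    by (rule has_derivative_transform_within_open[OF _ \<open>open U\<close> that Suc.prems(1)])
      (use Suc.prems(2) that in \<open>auto simp: frechet_derivative_works\<close>)
  show ?case
  proof (unfold Ck_on.simps, intro conjI allI ballI)
    show "g differentiable at x" if "x \<in> U" for x
      using d[OF that] by (auto simp: differentiable_def)
    show "Ck_on k U (\<lambda>x. frechet_derivative g (at x) v)" for v
    proof (rule Suc.IH)
      show "Ck_on k U (\<lambda>x. frechet_derivative f (at x) v)" using Suc.prems by simp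
      show "frechet_derivative f (at x) v = frechet_derivative g (at x) v" if "x \<in> U" for x
        using frechet_derivative_at[OF d[OF that]] by simp
    qed
  qed
qed

text \<open>Trades the choice made by \<open>frechet_derivative\<close> for any explicit family of
  derivatives; with \<open>Ck_on_SucE\<close> it turns the calculus rules into inductions on
  \<open>k\<close>.\<close>

lemma Ck_on_SucI:
  assumes "open U" "\<And>x. x \<in> U \<Longrightarrow> (f has_derivative D x) (at x)"
    "\<And>v. Ck_on k U (\<lambda>x. D x v)"
  shows "Ck_on (Suc k) U f"
  unfolding Ck_on.simps
proof (intro conjI ballI allI)
  show "f differentiable at x" if "x \<in> U" for x
    using assms(2) that by (auto simp: differentiable_def)
  show "Ck_on k U (\<lambda>x. frechet_derivative f (at x) v)" for v
    by (rule Ck_on_cong[OF assms(1) _ assms(3)[of v]])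
      (use frechet_derivative_at[OF assms(2)] in auto)
qed

lemma Ck_on_SucE:
  assumes "Ck_on (Suc k) U f"
  obtains D where "\<forall>x\<in>U. (f has_derivative D x) (at x)" "\<forall>v. Ck_on k U (\<lambda>x. D x v)"
proof (rule that[of "\<lambda>x. frechet_derivative f (at x)"])
qed (use assms in \<open>simp_all add: frechet_derivative_works\<close>)

declare Ck_on.simps(2) [simp del]

lemma Ck_on_const: "open U \<Longrightarrow> Ck_on k U (\<lambda>_. c)"
  by (induction k arbitrary: c) (auto intro!: Ck_on_SucI[where D = "\<lambda>_ _. 0"])

lemma Ck_on_bounded_linear: "open U \<Longrightarrow> bounded_linear L \<Longrightarrow> Ck_on k U L"
  by (cases k)
    (auto intro!: Ck_on_SucI[where D = "\<lambda>_. L"] bounded_linear_imp_has_derivative Ck_on_const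
      intro: linear_continuous_on)

lemma Ck_on_bounded_linear_compose:
  assumes "open U" "bounded_linear L" "Ck_on k U f"
  shows "Ck_on k U (\<lambda>x. L (f x))"
  using assms(3)
proof (induction k arbitrary: f)
  case 0
  then show ?case by (simp add: bounded_linear.continuous_on[OF assms(2)])
next
  case (Suc k)
  obtain D where D[rule_format]: "\<forall>x\<in>U. (f has_derivative D x) (at x)"
    "\<forall>v. Ck_on k U (\<lambda>x. D x v)" using Suc.prems by (rule Ck_on_SucE)
  show ?case
    by (rule Ck_on_SucI[OF assms(1) bounded_linear.has_derivative[OF assms(2) D(1)]])
      (auto intro: Suc.IH D)
qed

lemma Ck_on_add:
  assumes "open U" "Ck_on k U f" "Ck_on k U g"
  shows "Ck_on k U (\<lambda>x. f x + g x)"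
  using assms(2,3)
proof (induction k arbitrary: f g)
  case 0
  then show ?case by (simp add: continuous_on_add)
next
  case (Suc k)
  obtain D where D[rule_format]: "\<forall>x\<in>U. (f has_derivative D x) (at x)"
    "\<forall>v. Ck_on k U (\<lambda>x. D x v)" using Suc.prems(1) by (rule Ck_on_SucE)
  obtain E where E[rule_format]: "\<forall>x\<in>U. (g has_derivative E x) (at x)"
    "\<forall>v. Ck_on k U (\<lambda>x. E x v)" using Suc.prems(2) by (rule Ck_on_SucE)
  show ?case
    by (rule Ck_on_SucI[OF assms(1) has_derivative_add[OF D(1) E(1)]])
      (auto intro: Suc.IH D E)
qed

lemma Ck_on_bounded_bilinear:
  assumes "open U" "bounded_bilinear B" "Ck_on k U f" "Ck_on k U g"
  shows "Ck_on k U (\<lambda>x. B (f x) (g x))"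
  using assms(3,4)
proof (induction k arbitrary: f g)
  case 0
  then show ?case by (simp add: bounded_bilinear.continuous_on[OF assms(2)])
next
  case (Suc k)
  obtain D where D[rule_format]: "\<forall>x\<in>U. (f has_derivative D x) (at x)"
    "\<forall>v. Ck_on k U (\<lambda>x. D x v)" using Suc.prems(1) by (rule Ck_on_SucE)
  obtain E where E[rule_format]: "\<forall>x\<in>U. (g has_derivative E x) (at x)"
    "\<forall>v. Ck_on k U (\<lambda>x. E x v)" using Suc.prems(2) by (rule Ck_on_SucE)
  show ?case
    by (rule Ck_on_SucI[OF assms(1) bounded_bilinear.FDERIV[OF assms(2) D(1) E(1)]])
      (assumption+, rule Ck_on_add[OF assms(1) Suc.IH[OF Ck_on_SucD[OF Suc.prems(1)] E(2)]
          Suc.IH[OF D(2) Ck_on_SucD[OF Suc.prems(2)]]])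
qed

lemma Ck_on_diff:
  assumes "open U" "Ck_on k U f" "Ck_on k U g"
  shows "Ck_on k U (\<lambda>x. f x - g x)"
  using Ck_on_add[OF assms(1,2) Ck_on_bounded_linear_compose[OF assms(1)
        bounded_linear_minus[OF bounded_linear_ident] assms(3)]] by simp

lemmas Ck_on_mult = Ck_on_bounded_bilinear[OF _ bounded_bilinear_mult]

lemma Ck_on_sum:
  assumes "open U" "\<And>i. i \<in> I \<Longrightarrow> Ck_on k U (f i)"
  shows "Ck_on k U (\<lambda>x. \<Sum>i\<in>I. f i x)"
  using assms(2)
  by (induction I rule: infinite_finite_induct) (auto intro: Ck_on_const Ck_on_add assms(1))

lemma Ck_on_Pair:
  assumes "open U" "Ck_on k U f" "Ck_on k U g"
  shows "Ck_on k U (\<lambda>x. (f x, g x))"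
proof -
  have 1: "Ck_on k U (\<lambda>x. (f x, 0))"
    by (rule Ck_on_bounded_linear_compose[OF assms(1) _ assms(2), of "\<lambda>y. (y, 0)"])
      (intro bounded_linear_Pair bounded_linear_ident bounded_linear_zero)
  have 2: "Ck_on k U (\<lambda>x. (0, g x))"
    by (rule Ck_on_bounded_linear_compose[OF assms(1) _ assms(3), of "\<lambda>y. (0, y)"])
      (intro bounded_linear_Pair bounded_linear_ident bounded_linear_zero)
  show ?thesis using Ck_on_add[OF assms(1) 1 2] by simp
qed

lemma Ck_on_compose:
  fixes f :: "'a::real_normed_vector \<Rightarrow> 'b::euclidean_space" and g :: "'b \<Rightarrow> 'c::real_normed_vector"
  assumes "open U" "open V" "Ck_on k U f" "Ck_on k V g" "f ` U \<subseteq> V"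
  shows "Ck_on k U (\<lambda>x. g (f x))"
  using assms(3,4)
proof (induction k arbitrary: g)
  case 0
  then show ?case
    using assms(5) by (auto intro: continuous_on_compose2)
next
  case (Suc k)
  obtain D where D[rule_format]: "\<forall>x\<in>U. (f has_derivative D x) (at x)"
    "\<forall>v. Ck_on k U (\<lambda>x. D x v)" using Suc.prems(1) by (rule Ck_on_SucE)
  obtain E where E[rule_format]: "\<forall>x\<in>V. (g has_derivative E x) (at x)"
    "\<forall>v. Ck_on k V (\<lambda>x. E x v)" using Suc.prems(2) by (rule Ck_on_SucE)
  have fk: "Ck_on k U f" by (rule Ck_on_SucD[OF Suc.prems(1)])
  show ?case
  proof (rule Ck_on_SucI[OF assms(1)])
    fix x assume x: "x \<in> U"
    have fx: "f x \<in> V" using x assms(5) by auto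
    have lin: "linear (E (f x))" using E(1)[OF fx] by (rule has_derivative_linear)
    \<comment> \<open>The direction \<open>D x v\<close> moves with \<open>x\<close>, while
      \<open>Ck_on\<close> controls \<open>E\<close> in fixed directions only; expanding in the
      finite basis separates the two.\<close>
    have eq: "E (f x) w = (\<Sum>b\<in>Basis. (w \<bullet> b) *\<^sub>R E (f x) b)" for w
    proof -
      have "E (f x) w = E (f x) (\<Sum>b\<in>Basis. (w \<bullet> b) *\<^sub>R b)"
        by (simp only: euclidean_representation)
      then show ?thesis by (simp only: linear_sum[OF lin] linear_scale[OF lin])
    qed
    show "((\<lambda>x. g (f x)) has_derivative (\<lambda>v. \<Sum>b\<in>Basis. (D x v \<bullet> b) *\<^sub>R E (f x) b)) (at x)"
      unfolding eq[symmetric] by (rule has_derivative_compose[OF D(1)[OF x] E(1)[OF fx]])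
  next
    fix v
    show "Ck_on k U (\<lambda>x. \<Sum>b\<in>Basis. (D x v \<bullet> b) *\<^sub>R E (f x) b)"
    proof (rule Ck_on_sum[OF assms(1)])
      fix b :: 'b
      have "Ck_on k U (\<lambda>x. D x v \<bullet> b)"
        by (rule Ck_on_bounded_linear_compose[OF assms(1) bounded_linear_inner_left D(2)])
      moreover have "Ck_on k U (\<lambda>x. E (f x) b)"
        by (rule Suc.IH[OF fk E(2)])
      ultimately show "Ck_on k U (\<lambda>x. (D x v \<bullet> b) *\<^sub>R E (f x) b)"
        by (rule Ck_on_bounded_bilinear[OF assms(1) bounded_bilinear_scaleR])
    qed
  qed
qed

text \<open>The derivative is a polynomial in \<open>inverse\<close> itself, so each order of
  smoothness yields the next.\<close>

lemma Ck_on_inverse: "Ck_on k (- {0}) (inverse :: real \<Rightarrow> real)"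
proof (induction k)
  case 0
  then show ?case by (auto intro!: continuous_intros)
next
  case (Suc k)
  have o: "open (- {0 :: real})" by (rule open_Compl) simp
  have "Ck_on k (- {0}) (\<lambda>x. - (inverse x * v * inverse x))" for v :: real
    by (rule Ck_on_bounded_linear_compose[OF o bounded_linear_minus[OF bounded_linear_ident]
          Ck_on_mult[OF o Ck_on_mult[OF o Suc Ck_on_const[OF o]] Suc]])
  then show ?case
    by (rule Ck_on_SucI[OF o, rotated]) (rule has_derivative_inverse', simp)
qed

lemma Ck_on_divide:
  fixes f g :: "'a::real_normed_vector \<Rightarrow> real"
  assumes "open U" "Ck_on k U f" "Ck_on k U g" "\<And>x. x \<in> U \<Longrightarrow> g x \<noteq> 0"
  shows "Ck_on k U (\<lambda>x. f x / g x)"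
proof -
  have "Ck_on k U (\<lambda>x. inverse (g x))"
    by (rule Ck_on_compose[OF assms(1) _ assms(3) Ck_on_inverse]) (use assms(4) in auto)
  then show ?thesis
    unfolding divide_inverse by (rule Ck_on_mult[OF assms(1,2)])
qed

lemma Ck_on_arctan: "Ck_on k UNIV arctan"
proof (cases k)
  case 0
  have "continuous_on UNIV arctan"
    by (rule continuous_on_arctan[OF continuous_on_id])
  then show ?thesis using 0 by simp
next
  case (Suc m)
  have id: "Ck_on m UNIV (\<lambda>x::real. x)"
    by (rule Ck_on_bounded_linear[OF open_UNIV bounded_linear_ident])
  have 1: "Ck_on m UNIV (\<lambda>x::real. 1 + x * x)"
    by (rule Ck_on_add[OF open_UNIV Ck_on_const[OF open_UNIV] Ck_on_mult[OF open_UNIV id id]])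
  have nz: "1 + x * x \<noteq> 0" for x :: real
    using zero_le_square[of x] by linarith
  have "Ck_on (Suc m) UNIV arctan"
  proof (rule Ck_on_SucI[OF open_UNIV])
    show "(arctan has_derivative (\<lambda>v. inverse (1 + x * x) * v)) (at x)" for x :: real
      using DERIV_arctan[of x] unfolding has_field_derivative_def power2_eq_square .
    have "Ck_on m UNIV (\<lambda>x. v / (1 + x * x))" for v :: real
      by (rule Ck_on_divide[OF open_UNIV Ck_on_const[OF open_UNIV] 1 nz])
    then show "Ck_on m UNIV (\<lambda>x. inverse (1 + x * x) * v)" for v :: real
      by (simp only: divide_inverse mult.commute)
  qed
  then show ?thesis using Suc by simp
qed

text \<open>The inverse of the fibre-preserving map \<open>A(s, t) = (s, \<alpha>(s, t))\<close>; smoothness is bootstrapped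
  from the formula for the derivative of the inverse.\<close>

lemma Ck_on_fibre_inverse:
  fixes \<alpha> \<sigma> :: "real \<times> real \<Rightarrow> real"
  assumes "open V" "open W" "Ck_on (Suc k) V \<alpha>"
    and d2: "\<And>p. p \<in> V \<Longrightarrow> frechet_derivative \<alpha> (at p) (0, 1) \<noteq> 0"
    and A: "\<And>s t. (s, t) \<in> V \<Longrightarrow> \<sigma> (s, \<alpha> (s, t)) = t"
    and B: "\<And>s y. (s, y) \<in> W \<Longrightarrow> (s, \<sigma> (s, y)) \<in> V \<and> \<alpha> (s, \<sigma> (s, y)) = y"
  shows "Ck_on (Suc k) W \<sigma>"
proof -
  define D where "D p = frechet_derivative \<alpha> (at p)" for p
  have D: "(\<alpha> has_derivative D p) (at p)" if "p \<in> V" for p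
    using assms(3) that unfolding D_def Ck_on.simps frechet_derivative_works by blast
  have Dk: "Ck_on k V (\<lambda>p. D p v)" for v
    using assms(3) unfolding D_def Ck_on.simps by blast
  define f where "f p = (fst p, \<alpha> p)" for p
  define g where "g p = (fst p, \<sigma> p)" for p
  \<comment> \<open>The derivative of \<open>f\<close> is triangular, with 1 and the partial
    derivative in direction \<open>(0, 1)\<close> on the diagonal; this is its inverse.\<close>
  define G where "G p v = (fst v, (snd v - fst v * D (g p) (1, 0)) / D (g p) (0, 1))"
    for p and v :: "real \<times> real"
  have gV: "g p \<in> V" if "p \<in> W" for p
    using B[of "fst p" "snd p"] that by (auto simp: g_def)
  have der: "(g has_derivative G p) (at p)" if p: "p \<in> W" for p
  proof (rule has_derivative_inverse_strong_x[where S = V and f = f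
        and f' = "\<lambda>v. (fst v, D (g p) v)"])
    show "continuous_on V f"
      unfolding f_def using Ck_on_imp_continuous_on[OF assms(3)]
      by (auto intro!: continuous_intros)
    show "g (f x) = x" if "x \<in> V" for x
      using A[of "fst x" "snd x"] that by (auto simp: f_def g_def)
    show "f (g p) = p"
      using B[of "fst p" "snd p"] p by (auto simp: f_def g_def)
    show "(f has_derivative (\<lambda>v. (fst v, D (g p) v))) (at (g p))"
      unfolding f_def by (intro has_derivative_Pair has_derivative_fst has_derivative_ident D gV p)
    interpret linear "D (g p)" by (rule has_derivative_linear[OF D[OF gV[OF p]]])
    have lin: "D (g p) v = fst v * D (g p) (1, 0) + snd v * D (g p) (0, 1)" for v
      using add[of "fst v *\<^sub>R (1, 0)" "snd v *\<^sub>R (0, 1)"] by (simp only: scaleR) simp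
    show "(\<lambda>v. (fst v, D (g p) v)) \<circ> G p = id"
    proof
      fix v
      show "((\<lambda>v. (fst v, D (g p) v)) \<circ> G p) v = id v"
        using d2[OF gV[OF p]] unfolding o_def D_def[symmetric]
        by (subst lin) (cases v, simp add: G_def)
    qed
  qed (use assms gV p in auto)
  have step: "Ck_on (Suc m) W g" if "m \<le> k" "Ck_on m W g" for m
  proof (rule Ck_on_SucI[OF assms(2) der])
    fix v
    have "Ck_on m W (\<lambda>p. D (g p) w)" for w
      by (rule Ck_on_compose[OF assms(2,1) that(2) Ck_on_le[OF Dk that(1)]]) (use gV in auto)
    then show "Ck_on m W (\<lambda>p. G p v)"
      unfolding G_def using d2 gV unfolding D_def[symmetric]
      by (intro Ck_on_Pair Ck_on_const Ck_on_divide Ck_on_diff Ck_on_mult assms(2)) auto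
  qed
  have g0: "Ck_on 0 W g"
    using der by (auto intro!: continuous_at_imp_continuous_on has_derivative_continuous)
  have "Ck_on m W g" if "m \<le> Suc k" for m
    using that
  proof (induction m)
    case 0 then show ?case using g0 by simp
  next
    case (Suc m) then show ?case using step[of m] by simp
  qed
  then have "Ck_on (Suc k) W (\<lambda>p. snd (g p))"
    by (intro Ck_on_bounded_linear_compose[OF _ bounded_linear_snd] assms(2)) auto
  then show ?thesis by (simp add: g_def del: Ck_on.simps)
qed

section \<open>Simple closed plane curves of positive curvature\<close>

text \<open>\<open>m\<close> takes every value between its end values, and an interval longer than
  \<open>pi\<close> contains points of negative sine. In Hopf's argument this bounds the turning of
  the secant along each side of the domain.\<close>

lemma sin_nonneg_interval_short:
  fixes m :: "real \<Rightarrow> real"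
  assumes "a \<le> b" "continuous_on {a..b} m" "\<And>x. x \<in> {a..b} \<Longrightarrow> 0 \<le> sin (m x)"
  shows "\<bar>m b - m a\<bar> \<le> pi"
proof (rule ccontr)
  assume *: "\<not> ?thesis"
  define c where "c = min (m a) (m b)"
  define d where "d = max (m a) (m b)"
  have cd: "c + pi < d" using * by (auto simp: c_def d_def)
  have nn: "0 \<le> sin y" if "c \<le> y" "y \<le> d" for y
  proof -
    have "\<exists>x. a \<le> x \<and> x \<le> b \<and> m x = y"
      using that assms(1,2) IVT'[of m a y b] IVT2'[of m b y a]
      by (cases "m a \<le> m b") (auto simp: c_def d_def)
    then show ?thesis using assms(3) by auto
  qed
  have z: "sin y = 0" if "c \<le> y" "y \<le> d - pi" for y
    using nn[of y] nn[of "y + pi"] that by (simp add: pi_gt_zero order.trans)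
  \<comment> \<open>\<open>c\<close> and \<open>c + e\<close> are both zeros of the sine, at a
    distance of at most 1 < \<open>pi\<close>, where \<open>sin e\<close> is still positive.\<close>
  define e where "e = min (d - pi - c) 1"
  have e: "0 < e" "e \<le> 1" using cd by (auto simp: e_def)
  have "sin c = 0" "sin (c + e) = 0" using cd e by (auto intro!: z simp: e_def)
  then have "cos c * sin e = 0" by (simp add: sin_add)
  moreover have "sin e > 0" using e pi_gt3 by (intro sin_gt_zero) auto
  ultimately show False using \<open>sin c = 0\<close> sin_cos_squared_add[of c] by simp
qed

section \<open>Periodic functions and reduction modulo the period\<close>

lemma periodic_of_int:
  fixes f :: "real \<Rightarrow> 'a"
  assumes "\<And>x. f (x + l) = f x"
  shows "f (x + of_int n * l) = f x"
proof -
  have nat: "f (x + of_nat n * l) = f x" for x n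
  proof (induction n)
    case (Suc n)
    have "x + of_nat (Suc n) * l = (x + of_nat n * l) + l" by (simp add: algebra_simps)
    then show ?case using Suc assms by metis
  qed simp
  show ?thesis
  proof (cases "0 \<le> n")
    case True
    then show ?thesis using nat[of x "nat n"] by simp
  next
    case False
    then show ?thesis using nat[of "x + of_int n * l" "nat (- n)"] by simp
  qed
qed

lemma rmod_eq: "0 < l \<Longrightarrow> x rmod l = x + of_int (- \<lfloor>x / l\<rfloor>) * l"
  by (simp add: rmod_def)

lemma periodic_rmod:
  fixes f :: "real \<Rightarrow> 'a"
  assumes "\<And>x. f (x + l) = f x" "0 < l"
  shows "f (x rmod l) = f x"
  unfolding rmod_eq[OF assms(2)] by (rule periodic_of_int[of f, OF assms(1)])

lemma vector_derivative_periodic: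
  fixes f :: "real \<Rightarrow> 'a::real_normed_vector"
  assumes "\<And>s. (f has_vector_derivative f' s) (at s)" "\<And>s. f (s + l) = f s"
  shows "f' (s + l) = f' s"
proof -
  have "((\<lambda>x. x + l) has_vector_derivative 1) (at s)"
    by (auto intro!: derivative_eq_intros)
  from vector_diff_chain_at[OF this assms(1)[of "s + l"]]
  have "(f has_vector_derivative f' (s + l)) (at s)" by (simp add: o_def assms(2))
  then show ?thesis by (rule vector_derivative_unique_at) (rule assms(1))
qed

text \<open>The speed is arbitrary because the curve will be the central projection of one
  parameterized by arclength. \<open>Im (cnj a * b)\<close> is the determinant of the plane vectors
  \<open>a\<close> and \<open>b\<close>.\<close>

locale locally_convex_closed_curve =
  fixes p p' p'' :: "real \<Rightarrow> complex" and l :: real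
  assumes l_pos: "0 < l"
    and deriv1: "\<And>s. (p has_vector_derivative p' s) (at s)"
    and deriv2: "\<And>s. (p' has_vector_derivative p'' s) (at s)"
    and periodic: "\<And>s. p (s + l) = p s"
    and simple: "inj_on p {0..<l}"
    and turning_left: "\<And>s. 0 < Im (cnj (p' s) * p'' s)"
begin

lemma p'_nonzero: "p' s \<noteq> 0"
  using turning_left[of s] by auto

lemma continuous_p': "continuous_on A p'"
  using deriv2 by (meson continuous_at_imp_continuous_on has_vector_derivative_continuous)

lemma periodic': "p' (s + l) = p' s"
  by (rule vector_derivative_periodic[OF deriv1 periodic])

lemma periodic'': "p'' (s + l) = p'' s"
  by (rule vector_derivative_periodic[OF deriv2 periodic'])

text \<open>Moves injectivity from the window \<open>{0..<l}\<close> to windows with any starting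
  point; after reduction \<open>t\<close> lies in the window of \<open>s\<close> or in the next
  one.\<close>

lemma p_neq:
  assumes "s < t" "t < s + l"
  shows "p s \<noteq> p t"
proof
  assume eq: "p s = p t"
  define k where "k = \<lfloor>s / l\<rfloor>"
  have k: "of_int k * l \<le> s" "s < of_int k * l + l"
    using floor_divide_lower[OF l_pos, of s] floor_divide_upper[OF l_pos, of s]
    by (auto simp: k_def algebra_simps)
  define t' where "t' = (if t < of_int k * l + l then t - of_int k * l else t - of_int (k + 1) * l)"
  have "p (s - of_int k * l) = p s" "p t' = p t"
    using periodic_of_int[of p, OF periodic, of s "- k"] periodic_of_int[of p, OF periodic, of t "- k"]
      periodic_of_int[of p, OF periodic, of t "- (k + 1)"]
    by (auto simp: t'_def algebra_simps)
  moreover have "s - of_int k * l \<in> {0..<l}" "t' \<in> {0..<l}"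
    using k assms by (auto simp: t'_def algebra_simps)
  ultimately have "s - of_int k * l = t'" using eq by (intro inj_onD[OF simple]) simp_all
  then show False using assms k by (auto simp: t'_def algebra_simps split: if_splits)
qed

text \<open>The divided difference of \<open>p\<close>, in Hadamard's integral form, which is
  continuous across the diagonal.\<close>

definition dd :: "real \<times> real \<Rightarrow> complex" where
  "dd z = integral {0..1} (\<lambda>u. p' (fst z + u * (snd z - fst z)))"

lemma continuous_dd: "continuous_on A dd"
proof -
  have "continuous_on (UNIV \<times> cbox 0 (1::real)) (\<lambda>(z, u). p' (fst z + u * (snd z - fst z)))"
    unfolding case_prod_unfold
    by (rule continuous_on_compose2[OF continuous_p'[of UNIV]]) (auto intro!: continuous_intros)
  from integral_continuous_on_param[OF this] have "continuous_on UNIV dd"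
    unfolding dd_def[abs_def] by simp
  then show ?thesis by (rule continuous_on_subset) simp
qed

lemma dd_diag: "dd (s, s) = p' s"
  by (simp add: dd_def)

lemma dd_mult: "complex_of_real (t - s) * dd (s, t) = p t - p s"
proof -
  have "((\<lambda>u. (t - s) *\<^sub>R p' (s + u * (t - s))) has_integral
      (p (s + 1 * (t - s)) - p (s + 0 * (t - s)))) {0..1}"
  proof (rule fundamental_theorem_of_calculus)
    fix u :: real
    have "((\<lambda>u. s + u * (t - s)) has_vector_derivative (t - s)) (at u)"
      by (auto intro!: derivative_eq_intros)
    from vector_diff_chain_at[OF this deriv1]
    show "((\<lambda>u. p (s + u * (t - s))) has_vector_derivative (t - s) *\<^sub>R p' (s + u * (t - s)))
        (at u within {0..1})"
      by (simp add: o_def has_vector_derivative_at_within)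
  qed simp
  from integral_unique[OF this] show ?thesis
    by (simp add: dd_def scaleR_conv_of_real)
qed

text \<open>A positive multiple of the secant \<open>p t - p s\<close> for \<open>s < t < s + l\<close>, which extends continuously
  by the tangents \<open>p' s\<close> at \<open>t = s\<close> and \<open>- p' s\<close> at \<open>t = s + l\<close>, as in Hopf's proof of the
  Umlaufsatz.\<close>

definition secant :: "real \<times> real \<Rightarrow> complex" where
  "secant z = dd z - dd (fst z, snd z - l)"

lemma p_minus: "p (s - l) = p s"
  using periodic[of "s - l"] by simp

lemma secant_start: "secant (s, s) = p' s"
  using dd_mult[of "s - l" s] l_pos by (simp add: secant_def dd_diag p_minus)

lemma secant_end: "secant (s, s + l) = - p' s"
  using dd_mult[of "s + l" s] l_pos by (simp add: secant_def dd_diag periodic)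

text \<open>By periodicity both divided differences have the numerator \<open>p t - p s\<close>;
  their denominators \<open>t - s\<close> and \<open>t - s - l\<close> have opposite signs, so
  partial fractions give a positive factor.\<close>

lemma secant_mid:
  assumes "s < t" "t < s + l"
  shows "secant (s, t) = of_real (l / ((t - s) * (l - (t - s)))) * (p t - p s)"
proof -
  define w where "w = t - s"
  have w: "w \<noteq> 0" "l - w \<noteq> 0" using assms by (auto simp: w_def)
  have 1: "dd (s, t) = (p t - p s) / of_real w"
    using dd_mult[of t s] w by (simp add: w_def field_simps)
  have "- of_real (l - w) * dd (s, t - l) = p t - p s"
    using dd_mult[of "t - l" s] by (simp add: p_minus w_def algebra_simps)
  then have 2: "dd (s, t - l) = - (p t - p s) / of_real (l - w)"
    using w by (simp add: field_simps del: of_real_diff)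
  have "l / (w * (l - w)) = 1 / w + 1 / (l - w)"
    using w by (simp add: field_simps)
  then have 3: "of_real (l / (w * (l - w))) = 1 / complex_of_real w + 1 / complex_of_real (l - w)"
    by (simp only: of_real_add of_real_divide of_real_1)
  show ?thesis
    unfolding secant_def w_def[symmetric] 3 fst_conv snd_conv 1 2
    by (simp only: distrib_right minus_divide_left[symmetric] diff_minus_eq_add
        times_divide_eq_left mult_1)
qed

lemma continuous_secant: "continuous_on A secant"
  unfolding secant_def[abs_def]
  by (intro continuous_on_diff continuous_dd continuous_on_compose2[OF continuous_dd[of UNIV]]
      continuous_intros) auto

lemma secant_nonzero:
  assumes "s \<le> t" "t \<le> s + l"
  shows "secant (s, t) \<noteq> 0"
proof -
  consider "t = s" | "t = s + l" | "s < t" "t < s + l" using assms by linarith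
  then show ?thesis
  proof cases
    case 3
    then have "l / ((t - s) * (l - (t - s))) \<noteq> 0" using l_pos by simp
    then show ?thesis using p_neq[OF 3] by (simp add: secant_mid[OF 3] del: of_real_divide of_real_mult)
  qed (use p'_nonzero in \<open>auto simp: secant_start secant_end\<close>)
qed

lemma lowest_point: obtains a where "\<forall>s. Im (p a) \<le> Im (p s)"
proof -
  have cp: "continuous_on A p" for A
    using deriv1 by (meson continuous_at_imp_continuous_on has_vector_derivative_continuous)
  have "continuous_on {0..l} (\<lambda>s. Im (p s))" by (intro continuous_intros cp)
  then obtain a where a: "\<forall>s\<in>{0..l}. Im (p a) \<le> Im (p s)"
    using continuous_attains_inf[of "{0..l}" "\<lambda>s. Im (p s)"] l_pos by auto
  have "Im (p a) \<le> Im (p s)" for s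
  proof -
    have "p (s rmod l) = p s" by (rule periodic_rmod[of p, OF periodic l_pos])
    moreover have "s rmod l \<in> {0..l}"
      using l_pos by (auto simp: rmod_nonneg rmod_le)
    ultimately show ?thesis using a by metis
  qed
  then show ?thesis using that by blast
qed

text \<open>Hopf's Umlaufsatz. \<open>secant\<close> has no zero on the convex set
  \<open>\<Delta>\<close>, hence has a continuous argument \<open>m\<close> there, and the tangent
  angle is \<open>m\<close> on the diagonal. Its increase over a period is a multiple of 2
  \<open>pi\<close>, positive by the curvature, and at most 2 \<open>pi\<close> when computed along
  the two other sides of the triangle over a lowest point.\<close>

lemma tangent_angle:
  obtains \<theta> where "\<forall>s. p' s = of_real (cmod (p' s)) * cis (\<theta> s)"
    "\<forall>s. \<theta> (s + l) = \<theta> s + 2 * pi" "strict_mono \<theta>" "continuous_on UNIV \<theta>"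
proof -
  define \<Delta> where "\<Delta> = {z :: real \<times> real. fst z \<le> snd z \<and> snd z \<le> fst z + l}"
  have "convex \<Delta>"
  proof -
    have "\<Delta> = {z. (1, -1) \<bullet> z \<le> 0} \<inter> {z. (-1, 1) \<bullet> z \<le> l}"
      by (auto simp: \<Delta>_def inner_Pair_0 inner_prod_def)
    then show ?thesis by (simp add: convex_Int convex_halfspace_le)
  qed
  then obtain \<Theta> where \<Theta>: "continuous_on \<Delta> \<Theta>" "\<And>z. z \<in> \<Delta> \<Longrightarrow> secant z = exp (\<Theta> z)"
    using continuous_logarithm_on_contractible[OF continuous_secant convex_imp_contractible]
      secant_nonzero unfolding \<Delta>_def by (metis (no_types, lifting) mem_Collect_eq prod.collapse)
  define m where "m z = Im (\<Theta> z)" for z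
  have cm: "continuous_on \<Delta> m" unfolding m_def by (intro continuous_intros \<Theta>)
  have polar: "secant z = of_real (cmod (secant z)) * cis (m z)" if "z \<in> \<Delta>" for z
    using \<Theta>(2)[OF that] by (simp add: exp_eq_polar m_def norm_mult)
  have sgn_m: "Im (secant z) = cmod (secant z) * sin (m z)" "secant z \<noteq> 0" if "z \<in> \<Delta>" for z
    using arg_cong[OF polar[OF that], of Im] secant_nonzero[of "fst z" "snd z"] that
    by (auto simp: \<Delta>_def)
  define \<theta> where "\<theta> s = m (s, s)" for s
  have dg: "(s, s) \<in> \<Delta>" for s using l_pos by (simp add: \<Delta>_def)
  have c\<theta>: "continuous_on UNIV \<theta>" unfolding \<theta>_def
    by (rule continuous_on_compose2[OF cm]) (auto intro!: continuous_intros dg)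
  have pol: "p' s = of_real (cmod (p' s)) * cis (\<theta> s)" for s
    using polar[OF dg[of s]] by (simp add: secant_start \<theta>_def)
  \<comment> \<open>So far \<open>\<theta>\<close> is only continuous. Near \<open>s\<close> it
    differs by the constant \<open>\<theta> s\<close> from the argument of
    \<open>p' t / p' s\<close>, which is close to 1, where the principal logarithm is
    differentiable.\<close>
  have der: "(\<theta> has_real_derivative Im (p'' s / p' s)) (at s)" for s
  proof -
    have "((\<lambda>t. p' t / p' s) has_vector_derivative p'' s / p' s) (at s)"
      unfolding divide_inverse
      using deriv2 by (rule has_vector_derivative_mult_left)
    moreover have "(Ln has_field_derivative inverse 1) (at (p' s / p' s))"
      using p'_nonzero[of s] has_field_derivative_Ln[of 1] by simp
    ultimately have "((\<lambda>t. Ln (p' t / p' s)) has_vector_derivative p'' s / p' s) (at s)"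
      using field_vector_diff_chain_at[of "\<lambda>t. p' t / p' s" "p'' s / p' s" s Ln "inverse 1"]
      by (simp add: o_def)
    from has_vector_derivative_add[OF bounded_linear.has_vector_derivative[OF bounded_linear_Im this]
        has_vector_derivative_const[of "\<theta> s"]]
    have "((\<lambda>t. Im (Ln (p' t / p' s)) + \<theta> s) has_vector_derivative Im (p'' s / p' s)) (at s)"
      by simp
    moreover have "\<forall>\<^sub>F t in nhds s. Im (Ln (p' t / p' s)) + \<theta> s = \<theta> t"
    proof -
      have "(\<theta> \<longlongrightarrow> \<theta> s) (nhds s)"
        using c\<theta> by (simp add: continuous_on_eq_continuous_at isCont_def
            tendsto_at_iff_tendsto_nhds)
      then have "\<forall>\<^sub>F t in nhds s. dist (\<theta> t) (\<theta> s) < pi"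
        by (rule tendstoD) simp
      then show ?thesis
      proof eventually_elim
        case (elim t)
        define r where "r = cmod (p' t) / cmod (p' s)"
        have r: "r > 0" using p'_nonzero by (simp add: r_def)
        have "p' t / p' s = of_real r * cis (\<theta> t - \<theta> s)"
          using p'_nonzero[of s] p'_nonzero[of t]
          by (subst pol[of t], subst pol[of s]) (simp add: r_def cis_divide[symmetric])
        also have "\<dots> = exp (of_real (ln r) + \<i> * of_real (\<theta> t - \<theta> s))"
          using r by (simp add: exp_add cis_conv_exp exp_of_real)
        finally have "Ln (p' t / p' s) = of_real (ln r) + \<i> * of_real (\<theta> t - \<theta> s)"
          using elim by (auto simp: dist_real_def intro!: Ln_exp)
        then show ?case by simp
      qed
    qed
    ultimately show ?thesis
      unfolding has_real_derivative_iff_has_vector_derivative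
      using has_vector_derivative_cong_ev[of UNIV "\<lambda>t. Im (Ln (p' t / p' s)) + \<theta> s" \<theta> s]
        p'_nonzero[of s] by simp
  qed
  have pos: "0 < Im (p'' s / p' s)" for s
  proof -
    have "p'' s / p' s = cnj (p' s) * p'' s / of_real ((cmod (p' s))\<^sup>2)"
      using complex_div_cnj[of "p'' s" "p' s"] by (simp only: mult.commute of_real_power)
    then show ?thesis using turning_left[of s] p'_nonzero[of s] by (simp add: Im_divide_of_real)
  qed
  have mono: "strict_mono \<theta>"
  proof (rule strict_monoI)
    show "\<theta> x < \<theta> y" if "x < y" for x y
      by (rule DERIV_pos_imp_increasing[OF that]) (use der pos in blast)
  qed
  \<comment> \<open>The turning over a period does not depend on its start, so it may be computed at
    the lowest point.\<close>
  have turn: "\<theta> (s + l) - \<theta> s = \<theta> (t + l) - \<theta> t" for s t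
  proof -
    have "((\<lambda>s. \<theta> (s + l) - \<theta> s) has_real_derivative 0) (at x)" for x
      using DERIV_diff[OF DERIV_shift[THEN iffD1, OF der[of "x + l"]] der[of x]]
      by (simp add: periodic' periodic'')
    then show ?thesis using DERIV_isconst_all by blast
  qed
  obtain a where a[rule_format]: "\<forall>s. Im (p a) \<le> Im (p s)" by (rule lowest_point)
  have hor: "Im (p' a) = 0"
  proof (rule DERIV_local_min[of "\<lambda>s. Im (p s)" _ a 1])
    show "((\<lambda>s. Im (p s)) has_real_derivative Im (p' a)) (at a)"
      using deriv1 by (simp add: has_real_derivative_iff_has_vector_derivative
          bounded_linear.has_vector_derivative[OF bounded_linear_Im])
  qed (use a in auto)
  \<comment> \<open>Secants that start at the lowest point go up, those that end there go down; in
    both cases the argument varies by at most \<open>pi\<close>.\<close>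
  have up: "0 \<le> Im (secant (a, t))" if t: "a \<le> t" "t \<le> a + l" for t
  proof -
    consider "t = a" | "t = a + l" | "a < t" "t < a + l" using t by linarith
    then show ?thesis
      by cases (use a hor l_pos in \<open>auto simp: secant_start secant_end secant_mid\<close>)
  qed
  have down: "Im (secant (s, a + l)) \<le> 0" if s: "a \<le> s" "s \<le> a + l" for s
  proof -
    consider "s = a" | "s = a + l" | "a < s" "s < a + l" using s by linarith
    then show ?thesis
      by cases (use a hor l_pos in \<open>auto simp: secant_start secant_end secant_mid periodic
        periodic' intro!: mult_nonneg_nonpos divide_nonpos_pos\<close>)
  qed
  have "\<bar>m (a, a + l) - m (a, a)\<bar> \<le> pi"
  proof (rule sin_nonneg_interval_short[of a "a + l" "\<lambda>t. m (a, t)"])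
    show "continuous_on {a..a + l} (\<lambda>t. m (a, t))"
      by (rule continuous_on_compose2[OF cm]) (auto intro!: continuous_intros simp: \<Delta>_def)
    fix t assume "t \<in> {a..a + l}"
    then have "(a, t) \<in> \<Delta>" "0 \<le> Im (secant (a, t))" by (auto simp: \<Delta>_def up)
    with sgn_m[OF this(1)] show "0 \<le> sin (m (a, t))" by (simp add: zero_le_mult_iff)
  qed (use l_pos in auto)
  moreover have "\<bar>- m (a + l, a + l) - - m (a, a + l)\<bar> \<le> pi"
  proof (rule sin_nonneg_interval_short[of a "a + l" "\<lambda>t. - m (t, a + l)"])
    show "continuous_on {a..a + l} (\<lambda>t. - m (t, a + l))"
      by (intro continuous_on_minus continuous_on_compose2[OF cm])
        (auto intro!: continuous_intros simp: \<Delta>_def)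
    fix t assume "t \<in> {a..a + l}"
    then have "(t, a + l) \<in> \<Delta>" "Im (secant (t, a + l)) \<le> 0" by (auto simp: \<Delta>_def down)
    with sgn_m[OF this(1)] show "0 \<le> sin (- m (t, a + l))" by (simp add: mult_le_0_iff)
  qed (use l_pos in auto)
  ultimately have le: "\<theta> (a + l) - \<theta> a \<le> 2 * pi" by (simp add: \<theta>_def abs_le_iff)
  have gt: "0 < \<theta> (a + l) - \<theta> a" using mono l_pos by (simp add: strict_mono_less)
  have "cis (\<theta> (a + l) - \<theta> a) = 1"
  proof -
    have "of_real (cmod (p' a)) * cis (\<theta> (a + l)) = of_real (cmod (p' a)) * cis (\<theta> a)"
      using pol[of a] pol[of "a + l"] unfolding periodic' by metis
    then show ?thesis using p'_nonzero[of a] by (simp add: cis_divide[symmetric])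
  qed
  then have "cos (\<theta> (a + l) - \<theta> a) = 1" by (metis cis.sel(1) one_complex.sel(1))
  then obtain n :: int where n: "\<theta> (a + l) - \<theta> a = of_int n * 2 * pi"
    by (auto simp: cos_one_2pi_int)
  have "0 < n" "n \<le> 1" using le gt pi_gt_zero unfolding n
    by (auto simp: zero_less_mult_iff)
  then have "n = 1" by simp
  then have "\<theta> (a + l) - \<theta> a = 2 * pi" using n by simp
  then have "\<theta> (s + l) = \<theta> s + 2 * pi" for s using turn[of s a] by simp
  then show ?thesis using that pol mono c\<theta> by blast
qed

text \<open>The distance \<open>G\<close> from the tangent at \<open>s\<close> has a derivative of
  the sign of \<open>sin (\<theta> t - \<theta> s)\<close>. As the tangent turns exactly once,
  \<open>G\<close> rises until the tangent is reversed at \<open>m\<close> and then falls; it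
  vanishes at both ends of the period, so it is positive in between.\<close>

theorem convex:
  assumes "s < t" "t < s + l"
  shows "0 < Im (cnj (p' s) * (p t - p s))"
proof -
  obtain \<theta> where \<theta>[rule_format]: "\<forall>s. p' s = of_real (cmod (p' s)) * cis (\<theta> s)"
    "\<forall>s. \<theta> (s + l) = \<theta> s + 2 * pi" "strict_mono \<theta>" "continuous_on UNIV \<theta>"
    by (rule tangent_angle)
  define G where "G t = Im (cnj (p' s) * (p t - p s))" for t
  have der: "(G has_real_derivative Im (cnj (p' s) * p' t)) (at t)" for t
    unfolding G_def has_real_derivative_iff_has_vector_derivative
    by (rule bounded_linear.has_vector_derivative[OF bounded_linear_Im])
      (auto intro!: derivative_eq_intros has_vector_derivative_mult_right deriv1)
  have sin: "Im (cnj (p' s) * p' t) = cmod (p' s) * cmod (p' t) * sin (\<theta> t - \<theta> s)" for t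
  proof -
    have "cnj (p' s) * p' t = of_real (cmod (p' s) * cmod (p' t)) * cis (\<theta> t - \<theta> s)"
      by (subst \<theta>(1)[of s], subst \<theta>(1)[of t]) (simp add: cis_cnj cis_mult)
    then show ?thesis by simp
  qed
  obtain m where m: "s \<le> m" "m \<le> s + l" "\<theta> m = \<theta> s + pi"
    using IVT'[of \<theta> s "\<theta> s + pi" "s + l"] \<theta>(2,4) l_pos by (auto intro: continuous_on_subset)
  have mono: "\<theta> x < \<theta> y \<longleftrightarrow> x < y" for x y using \<theta>(3) by (rule strict_mono_less)
  have cG: "continuous_on A G" for A
    using der by (meson DERIV_isCont continuous_at_imp_continuous_on)
  have G0: "G s = 0" "G (s + l) = 0" by (auto simp: G_def periodic)
  show ?thesis
  proof (cases "t \<le> m")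
    case True
    have "G s < G t"
    proof (rule DERIV_pos_imp_increasing_open[OF assms(1) _ cG])
      fix x assume "s < x" "x < t"
      then have "0 < sin (\<theta> x - \<theta> s)"
        using mono[of s x] mono[of x m] True m by (intro sin_gt_zero) auto
      then show "\<exists>y. (G has_real_derivative y) (at x) \<and> 0 < y"
        using der p'_nonzero by (metis sin mult_pos_pos zero_less_norm_iff)
    qed
    then show ?thesis using G0 by (simp add: G_def)
  next
    case False
    have "G t > G (s + l)"
    proof (rule DERIV_neg_imp_decreasing_open[OF assms(2) _ cG])
      fix x assume "t < x" "x < s + l"
      then have "sin (\<theta> x - \<theta> s) < 0"
        using mono[of m x] mono[of x "s + l"] False m \<theta>(2)[of s] by (intro sin_lt_zero) auto
      then show "\<exists>y. (G has_real_derivative y) (at x) \<and> y < 0"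
        using der p'_nonzero by (metis sin mult_pos_neg mult_pos_pos zero_less_norm_iff)
    qed
    then show ?thesis using G0 by (simp add: G_def)
  qed
qed

end

section \<open>Geometry of the two surfaces\<close>

text \<open>The curvature of the surface, which is also the value of \<open>form S X X\<close> at its points \<open>X\<close>.\<close>

definition curv :: "surface \<Rightarrow> real" where
  "curv S = (case S of Hemisphere \<Rightarrow> 1 | Hyperbolic_Plane \<Rightarrow> - 1)"

lemma curv_simps [simp]: "curv Hemisphere = 1" "curv Hyperbolic_Plane = - 1"
  by (simp_all add: curv_def)

lemma curv_sq [simp]: "curv S * curv S = 1" "curv S * (curv S * x) = x" "curv S \<noteq> 0"
  by (cases S; simp)+

lemma form_eq: "form S X Y = X $ 1 * Y $ 1 + X $ 2 * Y $ 2 + curv S * (X $ 3 * Y $ 3)"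
  by (cases S) (simp_all add: inner_vec_def sum_3)

lemma form_commute: "form S X Y = form S Y X"
  by (simp add: form_eq mult.commute)

lemma form_linear:
  "form S (X + Y) Z = form S X Z + form S Y Z" "form S X (Y + Z) = form S X Y + form S X Z"
  "form S (X - Y) Z = form S X Z - form S Y Z" "form S X (Y - Z) = form S X Y - form S X Z"
  "form S (c *\<^sub>R X) Z = c * form S X Z" "form S X (c *\<^sub>R Z) = c * form S X Z"
  "form S (- X) Z = - form S X Z" "form S X (- Z) = - form S X Z"
  by (simp_all add: form_eq algebra_simps)

lemma form_zero [simp]: "form S 0 Y = 0" "form S X 0 = 0"
  by (simp_all add: form_eq)

lemma points_iff: "X \<in> points S \<longleftrightarrow> form S X X = curv S \<and> 0 < X $ 3"
proof -
  have sqrt_iff: "x = sqrt a \<longleftrightarrow> x\<^sup>2 = a" if "0 < x" for x a :: real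
    using that real_sqrt_unique[of x a] real_sqrt_gt_0_iff[of a] by auto
  show ?thesis
  proof (cases S)
    case Hemisphere
    have "X $ 3 = sqrt (1 - (X $ 1)\<^sup>2 - (X $ 2)\<^sup>2) \<longleftrightarrow> (X $ 1)\<^sup>2 + (X $ 2)\<^sup>2 + (X $ 3)\<^sup>2 = 1"
      if "0 < X $ 3"
      unfolding sqrt_iff[OF that] by auto
    then show ?thesis using Hemisphere by (auto simp: form_eq power2_eq_square)
  next
    case Hyperbolic_Plane
    have "0 < 1 + (X $ 1)\<^sup>2 + (X $ 2)\<^sup>2" by (simp add: add_pos_nonneg)
    then have "0 < X $ 3" if "X $ 3 = sqrt (1 + (X $ 1)\<^sup>2 + (X $ 2)\<^sup>2)"
      using that by simp
    then have "X $ 3 = sqrt (1 + (X $ 1)\<^sup>2 + (X $ 2)\<^sup>2) \<longleftrightarrow>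
        (X $ 3)\<^sup>2 = 1 + (X $ 1)\<^sup>2 + (X $ 2)\<^sup>2 \<and> 0 < X $ 3"
      using sqrt_iff by metis
    then show ?thesis using Hyperbolic_Plane by (auto simp: form_eq power2_eq_square)
  qed
qed

definition det3 :: "real ^ 3 \<Rightarrow> real ^ 3 \<Rightarrow> real ^ 3 \<Rightarrow> real" where
  "det3 X Y Z = X $ 1 * (Y $ 2 * Z $ 3 - Y $ 3 * Z $ 2) - X $ 2 * (Y $ 1 * Z $ 3 - Y $ 3 * Z $ 1)
    + X $ 3 * (Y $ 1 * Z $ 2 - Y $ 2 * Z $ 1)"

lemma det3_linear:
  "det3 X Y (Z + W) = det3 X Y Z + det3 X Y W" "det3 X Y (Z - W) = det3 X Y Z - det3 X Y W"
  "det3 X Y (c *\<^sub>R Z) = c * det3 X Y Z"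
  by (simp_all add: det3_def algebra_simps)

lemma det3_same [simp]: "det3 X Y X = 0" "det3 X Y Y = 0" "det3 X X Y = 0"
  by (simp_all add: det3_def algebra_simps)

text \<open>The vector that represents the functional \<open>det3 X V\<close> with respect to
  \<open>form S\<close>: the cross product, with the sign of the form in the third
  coordinate.\<close>

definition normal :: "surface \<Rightarrow> real ^ 3 \<Rightarrow> real ^ 3 \<Rightarrow> real ^ 3" where
  "normal S X V = vector [X $ 2 * V $ 3 - X $ 3 * V $ 2, X $ 3 * V $ 1 - X $ 1 * V $ 3,
     curv S * (X $ 1 * V $ 2 - X $ 2 * V $ 1)]"

lemma normal_nth [simp]:
  "normal S X V $ 1 = X $ 2 * V $ 3 - X $ 3 * V $ 2"
  "normal S X V $ 2 = X $ 3 * V $ 1 - X $ 1 * V $ 3"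
  "normal S X V $ 3 = curv S * (X $ 1 * V $ 2 - X $ 2 * V $ 1)"
  by (simp_all add: normal_def)

lemma form_normal: "form S (normal S X V) Y = det3 X V Y"
  by (simp add: form_eq det3_def algebra_simps)

text \<open>Lagrange's identity for the form: the Gram determinant appears, and
  \<open>curv S\<close> is the determinant of the form.\<close>

lemma det3_normal_1:
  "det3 Y V (normal S X V) = curv S * (form S X Y * form S V V - form S V X * form S V Y)"
  by (cases S) (simp_all add: det3_def form_eq algebra_simps)

lemma det3_normal_2:
  "det3 X Y (normal S X V) = curv S * (form S X X * form S V Y - form S X V * form S X Y)"
  by (cases S) (simp_all add: det3_def form_eq algebra_simps)

lemma det3_cramer:
  "det3 X V W *\<^sub>R Y = det3 Y V W *\<^sub>R X + det3 X Y W *\<^sub>R V + det3 X V Y *\<^sub>R W"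
  by (simp add: vec_eq_iff forall_3 det3_def algebra_simps)

lemma frame_expansion:
  assumes "form S X X = curv S" "form S V V = 1" "form S X V = 0"
  shows "Y = (curv S * form S X Y) *\<^sub>R X + form S V Y *\<^sub>R V + det3 X V Y *\<^sub>R normal S X V"
    and "form S (normal S X V) (normal S X V) = 1"
proof -
  have 1: "det3 X V (normal S X V) = 1"
    unfolding det3_normal_1 using assms by (simp add: form_commute[of S V X])
  then show "form S (normal S X V) (normal S X V) = 1" by (simp add: form_normal)
  have "det3 Y V (normal S X V) = curv S * form S X Y" "det3 X Y (normal S X V) = form S V Y"
    unfolding det3_normal_1 det3_normal_2 using assms by (simp_all add: form_commute[of S V X])
  then show "Y = (curv S * form S X Y) *\<^sub>R X + form S V Y *\<^sub>R V + det3 X V Y *\<^sub>R normal S X V"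
    using det3_cramer[of X V "normal S X V" Y] 1 by simp
qed

lemma frame_pythagoras:
  assumes "form S X X = curv S" "form S V V = 1" "form S X V = 0"
  shows "form S Y Y = curv S * (form S X Y)\<^sup>2 + (form S V Y)\<^sup>2 + (det3 X V Y)\<^sup>2"
proof -
  have "form S Y Y = form S ((curv S * form S X Y) *\<^sub>R X + form S V Y *\<^sub>R V
      + det3 X V Y *\<^sub>R normal S X V) Y"
    using frame_expansion(1)[OF assms, of Y] by simp
  then show ?thesis
    by (simp add: form_linear form_normal power2_eq_square mult.assoc)
qed

lemma has_real_derivative_nth:
  "(f has_vector_derivative f') F \<Longrightarrow> ((\<lambda>x. f x $ i) has_real_derivative f' $ i) F"
  unfolding has_real_derivative_iff_has_vector_derivative
  by (rule bounded_linear.has_vector_derivative[OF bounded_linear_vec_nth])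

lemma has_real_derivative_form:
  assumes "(f has_vector_derivative f') (at x within T)" "(g has_vector_derivative g') (at x within T)"
  shows "((\<lambda>x. form S (f x) (g x)) has_real_derivative form S f' (g x) + form S (f x) g')
    (at x within T)"
  unfolding form_eq
  by (rule derivative_eq_intros has_real_derivative_nth assms refl)+ (simp add: algebra_simps)

lemma has_vector_derivative_Complex:
  assumes "(f has_real_derivative f') F" "(g has_real_derivative g') F"
  shows "((\<lambda>x. Complex (f x) (g x)) has_vector_derivative Complex f' g') F"
  unfolding Complex_eq
  using assms unfolding has_real_derivative_iff_has_vector_derivative
  by (intro has_vector_derivative_add has_vector_derivative_mult_right
      bounded_linear.has_vector_derivative[OF bounded_linear_of_real])

section \<open>The moving frame of an oval and its strict convexity\<close>

locale oval_curve =
  fixes S :: surface and j :: nat and l :: real and \<Gamma> :: "real \<Rightarrow> real ^ 3"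
  assumes j: "2 \<le> j" and oval: "oval S j l \<Gamma>"
begin

abbreviation "V \<equiv> velocity \<Gamma>"
abbreviation "N \<equiv> unit_normal S \<Gamma>"

definition A :: "real \<Rightarrow> real ^ 3" where "A s = vector_derivative V (at s)"

lemma l_pos: "0 < l"
  and range_\<Gamma>: "\<Gamma> s \<in> points S"
  and \<Gamma>_periodic: "\<Gamma> (s + l) = \<Gamma> s"
  and \<Gamma>_inj: "inj_on \<Gamma> {0..<l}"
  and form_VV: "form S (V s) (V s) = 1"
  and Ck_\<Gamma>: "Ck_on j UNIV \<Gamma>"
  and curvature: "0 < geodesic_curvature S \<Gamma> s"
  using oval by (auto simp: oval_def)

lemma \<Gamma>_deriv: "(\<Gamma> has_vector_derivative V s) (at s)"
  and Ck_V: "Ck_on (j - 1) UNIV V"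
proof -
  obtain k where k: "j = Suc k" using j by (cases j) auto
  have diff: "\<Gamma> differentiable at s" and Ck: "Ck_on k UNIV (\<lambda>x. frechet_derivative \<Gamma> (at x) 1)" for s
    using Ck_\<Gamma> unfolding k Ck_on.simps by blast+
  show d: "(\<Gamma> has_vector_derivative V s) (at s)" for s
    using diff by (simp add: vector_derivative_works)
  have "frechet_derivative \<Gamma> (at s) 1 = V s" for s
    using frechet_derivative_at[OF d[of s, unfolded has_vector_derivative_def]] by (metis scaleR_one)
  with Ck show "Ck_on (j - 1) UNIV V" by (simp add: k)
qed

lemma V_deriv: "(V has_vector_derivative A s) (at s)"
proof -
  obtain k where k: "j - 1 = Suc k" using j by (cases "j - 1") auto
  have "V differentiable at s"
    using Ck_V unfolding k Ck_on.simps by blast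
  then show ?thesis by (simp add: vector_derivative_works A_def)
qed

lemma form_\<Gamma>\<Gamma>: "form S (\<Gamma> s) (\<Gamma> s) = curv S"
  and \<Gamma>_3: "0 < \<Gamma> s $ 3"
  using range_\<Gamma>[of s] by (auto simp: points_iff)

lemma form_\<Gamma>V: "form S (\<Gamma> s) (V s) = 0"
proof -
  have "((\<lambda>s. form S (\<Gamma> s) (\<Gamma> s)) has_real_derivative 2 * form S (\<Gamma> s) (V s)) (at s)"
    using has_real_derivative_form[OF \<Gamma>_deriv \<Gamma>_deriv, of S s]
    by (simp add: form_commute[of S "V s"])
  then have "2 * form S (\<Gamma> s) (V s) = 0"
    unfolding form_\<Gamma>\<Gamma> by (rule DERIV_unique) simp
  then show ?thesis by simp
qed

lemmas frame = form_\<Gamma>\<Gamma> form_VV form_\<Gamma>V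

text \<open>The metric conditions leave two opposite vectors. The planar determinant of
  \<open>V s\<close> and this one equals the height \<open>\<Gamma> s $ 3\<close>, which is positive
  on both surfaces and so decides the sign.\<close>

lemma unit_normal_eq: "N s = normal S (\<Gamma> s) (V s)"
  unfolding unit_normal_def
proof (rule the_equality)
  let ?X = "\<Gamma> s" let ?V = "V s" let ?e = "normal S ?X ?V"
  have orient: "?V $ 1 * ?e $ 2 - ?V $ 2 * ?e $ 1 = ?X $ 3"
  proof -
    have "?V $ 1 * ?e $ 2 - ?V $ 2 * ?e $ 1 = ?X $ 3 * form S ?V ?V - ?V $ 3 * form S ?X ?V"
      by (simp add: form_eq algebra_simps)
    then show ?thesis by (simp add: frame)
  qed
  show "?e \<in> tangent_plane S ?X \<and> form S ?e ?e = 1 \<and> form S ?V ?e = 0 \<and>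
      0 < ?V $ 1 * ?e $ 2 - ?V $ 2 * ?e $ 1"
    unfolding orient using frame_expansion(2)[OF frame] \<Gamma>_3
    by (simp add: tangent_plane_def form_commute[of S _ ?e] form_normal)
  fix \<eta>
  assume *: "\<eta> \<in> tangent_plane S ?X \<and> form S \<eta> \<eta> = 1 \<and> form S ?V \<eta> = 0 \<and>
      0 < ?V $ 1 * \<eta> $ 2 - ?V $ 2 * \<eta> $ 1"
  define c where "c = det3 ?X ?V \<eta>"
  have \<eta>: "\<eta> = c *\<^sub>R ?e"
    using frame_expansion(1)[OF frame[of s], of \<eta>] * by (simp add: tangent_plane_def c_def)
  have "c\<^sup>2 = 1"
    using frame_pythagoras[OF frame[of s], of \<eta>] * by (simp add: tangent_plane_def c_def)
  moreover have "?V $ 1 * \<eta> $ 2 - ?V $ 2 * \<eta> $ 1 = c * (?V $ 1 * ?e $ 2 - ?V $ 2 * ?e $ 1)"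
    by (subst (1 2) \<eta>) (simp add: algebra_simps)
  then have "0 < c" using * \<Gamma>_3[of s] unfolding orient by (simp add: zero_less_mult_iff)
  ultimately have "c = 1" by (simp add: power2_eq_1_iff)
  then show "\<eta> = ?e" using \<eta> by simp
qed

text \<open>The normal is orthogonal to \<open>\<Gamma> s\<close>, so the projection to the tangent
  plane does not change the product with it: the geodesic curvature is this determinant.\<close>

lemma det3_A: "0 < det3 (\<Gamma> s) (V s) (A s)"
  using curvature[of s]
  unfolding geodesic_curvature_def A_def[symmetric] tangential_def unit_normal_eq
  by (simp add: form_linear form_commute[of S _ "normal S _ _"] form_normal)

text \<open>The coordinates of \<open>\<Gamma> t\<close> along the unit normal and the unit tangent at \<open>\<Gamma> s\<close>.\<close>

definition g :: "real \<Rightarrow> real \<Rightarrow> real" where "g s t = det3 (\<Gamma> s) (V s) (\<Gamma> t)"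
definition h :: "real \<Rightarrow> real \<Rightarrow> real" where "h s t = form S (V s) (\<Gamma> t)"

lemma g_pos_interval:
  assumes "s < t" "t < s + l"
  shows "0 < g s t"
proof -
  define p where "p s = Complex (\<Gamma> s $ 1 / \<Gamma> s $ 3) (\<Gamma> s $ 2 / \<Gamma> s $ 3)" for s
  define n where "n i s = V s $ i * \<Gamma> s $ 3 - \<Gamma> s $ i * V s $ 3" for i s
  \<comment> \<open>The derivative of \<open>n\<close>: the products of two velocity coordinates
    cancel.\<close>
  define m where "m i s = A s $ i * \<Gamma> s $ 3 - \<Gamma> s $ i * A s $ 3" for i s
  define q where "q i s = n i s / (\<Gamma> s $ 3)\<^sup>2" for i s
  define r where "r i s = m i s / (\<Gamma> s $ 3)\<^sup>2 - 2 * n i s * V s $ 3 / (\<Gamma> s $ 3) ^ 3" for i s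
  note d\<Gamma> = has_real_derivative_nth[OF \<Gamma>_deriv] and dV = has_real_derivative_nth[OF V_deriv]
  have nz: "\<Gamma> s $ 3 \<noteq> 0" for s using \<Gamma>_3[of s] by simp
  have d1: "((\<lambda>s. \<Gamma> s $ i / \<Gamma> s $ 3) has_real_derivative q i s) (at s)" for i s
    by (rule derivative_eq_intros d\<Gamma> nz refl)+ (simp add: q_def n_def power2_eq_square)
  have dn: "(n i has_real_derivative m i s) (at s)" for i s
    unfolding n_def
    by (rule derivative_eq_intros d\<Gamma> dV nz refl)+ (simp add: m_def)
  have d2: "(q i has_real_derivative r i s) (at s)" for i s
    unfolding q_def
    by (rule derivative_eq_intros d\<Gamma> dn nz refl)+
      (use nz[of s] in \<open>simp_all add: r_def field_simps power2_eq_square power3_eq_cube\<close>)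
  interpret p: locally_convex_closed_curve p "\<lambda>s. Complex (q 1 s) (q 2 s)" "\<lambda>s. Complex (r 1 s) (r 2 s)" l
  proof
    show "(p has_vector_derivative Complex (q 1 s) (q 2 s)) (at s)"
      "((\<lambda>s. Complex (q 1 s) (q 2 s)) has_vector_derivative Complex (r 1 s) (r 2 s)) (at s)" for s
      unfolding p_def by (intro has_vector_derivative_Complex d1 d2)+
    show "p (s + l) = p s" for s by (simp add: p_def \<Gamma>_periodic)
    show "inj_on p {0..<l}"
    proof (rule inj_onI)
      fix s t assume st: "s \<in> {0..<l}" "t \<in> {0..<l}" "p s = p t"
      define c where "c = \<Gamma> s $ 3 / \<Gamma> t $ 3"
      have c: "\<Gamma> s = c *\<^sub>R \<Gamma> t"
        using st(3) nz[of s] nz[of t] by (simp add: vec_eq_iff forall_3 p_def c_def field_simps)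
      have "curv S = c * c * curv S"
        using form_\<Gamma>\<Gamma>[of s] unfolding c by (simp add: form_linear form_\<Gamma>\<Gamma>)
      then have "c\<^sup>2 = 1" by (simp add: power2_eq_square)
      moreover have "0 < c" using \<Gamma>_3[of s] \<Gamma>_3[of t] by (simp add: c_def)
      ultimately have "c = 1" by (simp add: power2_eq_1_iff)
      then show "s = t" using c st inj_onD[OF \<Gamma>_inj] by simp
    qed
    \<comment> \<open>The part of \<open>r\<close> parallel to \<open>q\<close> drops out of the
      determinant. What remains is the determinant of \<open>\<Gamma>\<close>, \<open>V\<close> and
      \<open>A\<close> over a power of the height: the projection preserves the sign of the
      curvature.\<close>
    show "0 < Im (cnj (Complex (q 1 s) (q 2 s)) * Complex (r 1 s) (r 2 s))" for s
    proof -
      have "Im (cnj (Complex (q 1 s) (q 2 s)) * Complex (r 1 s) (r 2 s))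
          = (n 1 s * m 2 s - n 2 s * m 1 s) / (\<Gamma> s $ 3) ^ 4"
        using nz[of s] by (simp add: q_def r_def field_simps power2_eq_square power3_eq_cube
            power4_eq_xxxx)
      also have "n 1 s * m 2 s - n 2 s * m 1 s = \<Gamma> s $ 3 * det3 (\<Gamma> s) (V s) (A s)"
        by (simp add: n_def m_def det3_def algebra_simps)
      finally show ?thesis using det3_A[of s] \<Gamma>_3[of s] by simp
    qed
  qed (rule l_pos)
  have "Im (cnj (Complex (q 1 s) (q 2 s)) * (p t - p s)) = g s t / ((\<Gamma> s $ 3)\<^sup>2 * \<Gamma> t $ 3)"
  proof -
    have "Im (cnj (Complex (q 1 s) (q 2 s)) * (p t - p s))
      = (n 1 s * (\<Gamma> t $ 2 * \<Gamma> s $ 3 - \<Gamma> s $ 2 * \<Gamma> t $ 3)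
        - n 2 s * (\<Gamma> t $ 1 * \<Gamma> s $ 3 - \<Gamma> s $ 1 * \<Gamma> t $ 3)) / ((\<Gamma> s $ 3) ^ 3 * \<Gamma> t $ 3)"
      using nz[of s] nz[of t] by (simp add: q_def p_def field_simps power2_eq_square power3_eq_cube)
    also have "n 1 s * (\<Gamma> t $ 2 * \<Gamma> s $ 3 - \<Gamma> s $ 2 * \<Gamma> t $ 3)
        - n 2 s * (\<Gamma> t $ 1 * \<Gamma> s $ 3 - \<Gamma> s $ 1 * \<Gamma> t $ 3) = \<Gamma> s $ 3 * g s t"
      by (simp add: g_def n_def det3_def algebra_simps)
    finally show ?thesis
      using nz[of s] by (simp add: power2_eq_square power3_eq_cube)
  qed
  then have "0 < g s t / ((\<Gamma> s $ 3)\<^sup>2 * \<Gamma> t $ 3)"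
    using p.convex[OF assms] by argo
  moreover have "0 < (\<Gamma> s $ 3)\<^sup>2 * \<Gamma> t $ 3" using \<Gamma>_3[of t] nz[of s] by simp
  ultimately show ?thesis by (auto simp: zero_less_divide_iff)
qed

lemma \<Gamma>_shift: "\<Gamma> (s + of_int n * l) = \<Gamma> s"
  by (rule periodic_of_int[of \<Gamma>, OF \<Gamma>_periodic])

lemma \<Gamma>_rmod: "\<Gamma> (s rmod l) = \<Gamma> s"
  by (rule periodic_rmod[of \<Gamma>, OF \<Gamma>_periodic l_pos])

lemma V_periodic: "V (s + l) = V s"
  by (rule vector_derivative_periodic[of \<Gamma>, OF \<Gamma>_deriv \<Gamma>_periodic])

lemma V_rmod: "V (s rmod l) = V s"
  by (rule periodic_rmod[of V, OF V_periodic l_pos])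

lemma g_pos:
  assumes "\<Gamma> s \<noteq> \<Gamma> t"
  shows "0 < g s t"
proof -
  define d where "d = (t - s) rmod l"
  have eq: "s + d = t + of_int (- \<lfloor>(t - s) / l\<rfloor>) * l"
    by (simp add: d_def rmod_eq[OF l_pos])
  have t: "\<Gamma> (s + d) = \<Gamma> t" unfolding eq by (rule \<Gamma>_shift)
  have "d \<noteq> 0" using assms t by auto
  moreover have "0 \<le> d" "d < l" using l_pos by (auto simp: d_def rmod_nonneg rmod_less)
  ultimately have "0 < g s (s + d)" by (intro g_pos_interval) auto
  then show ?thesis by (simp add: g_def t)
qed

lemma \<Gamma>_eq_iff: "s \<in> {0..<l} \<Longrightarrow> t \<in> {0..<l} \<Longrightarrow> \<Gamma> s = \<Gamma> t \<longleftrightarrow> s = t"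
  using inj_on_eq_iff[OF \<Gamma>_inj] by blast

lemma \<Gamma>_neq:
  assumes "s < t" "t < s + l"
  shows "\<Gamma> s \<noteq> \<Gamma> t"
proof
  assume "\<Gamma> s = \<Gamma> t"
  then have "g s t = 0" by (simp add: g_def flip: \<open>\<Gamma> s = \<Gamma> t\<close>)
  then show False using g_pos_interval[OF assms] by simp
qed

end

section \<open>Angles between chords and the curve\<close>

lemma Ck_on_nth: "open U \<Longrightarrow> Ck_on k U f \<Longrightarrow> Ck_on k U (\<lambda>x. f x $ i)"
  by (rule Ck_on_bounded_linear_compose[OF _ bounded_linear_vec_nth])

lemma Ck_on_form:
  assumes "open U" "Ck_on k U f" "Ck_on k U g"
  shows "Ck_on k U (\<lambda>x. form S (f x) (g x))"
  unfolding form_eq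
  by (intro Ck_on_add Ck_on_mult Ck_on_const) (auto intro!: Ck_on_nth assms)

lemma Ck_on_det3:
  assumes "open U" "Ck_on k U f" "Ck_on k U g" "Ck_on k U h"
  shows "Ck_on k U (\<lambda>x. det3 (f x) (g x) (h x))"
  unfolding det3_def
  by (intro Ck_on_add Ck_on_mult Ck_on_diff) (auto intro!: Ck_on_nth assms)

text \<open>With \<open>X\<close>, \<open>V\<close> the point and tangent at \<open>s\<close> and
  \<open>Y\<close>, \<open>Z\<close> those at \<open>t\<close>, the left side is the numerator of
  the derivative of \<open>h / g\<close> in \<open>t\<close>; the frame relations reduce the right
  side to \<open>- g t s\<close>.\<close>

lemma form_det3_wedge:
  "form S V Z * det3 X V Y - form S V Y * det3 X V Z
    = form S X V * det3 Y Z V - form S V V * det3 Y Z X"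
  by (cases S) (simp_all add: det3_def form_eq algebra_simps)

lemma arccot_eqI:
  assumes "0 < \<psi>" "\<psi> < pi" "0 < g" "cos \<psi> * g = sin \<psi> * h"
  shows "pi / 2 - arctan (h / g) = \<psi>"
proof -
  have "0 < sin \<psi>" using assms by (intro sin_gt_zero)
  then have "h / g = cos \<psi> / sin \<psi>"
    using assms by (simp add: field_simps)
  also have "\<dots> = tan (pi / 2 - \<psi>)"
    by (simp add: tan_def cos_diff sin_diff)
  finally have "h / g = tan (pi / 2 - \<psi>)" .
  then show ?thesis using assms by (simp add: arctan_tan)
qed

lemma sin_arccot:
  assumes "0 < g"
  shows "sin (pi / 2 - arctan (h / g)) = g / sqrt (g\<^sup>2 + h\<^sup>2)"
    and "cos (pi / 2 - arctan (h / g)) = h / sqrt (g\<^sup>2 + h\<^sup>2)"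
proof -
  have "g\<^sup>2 + h\<^sup>2 = g\<^sup>2 * (1 + (h / g)\<^sup>2)"
    using assms by (simp add: field_simps)
  then have "sqrt (g\<^sup>2 + h\<^sup>2) = g * sqrt (1 + (h / g)\<^sup>2)"
    using assms by (simp add: real_sqrt_mult)
  moreover have "sqrt (1 + (h / g)\<^sup>2) \<noteq> 0"
    by (simp add: add_nonneg_eq_0_iff)
  ultimately show "sin (pi / 2 - arctan (h / g)) = g / sqrt (g\<^sup>2 + h\<^sup>2)"
    and "cos (pi / 2 - arctan (h / g)) = h / sqrt (g\<^sup>2 + h\<^sup>2)"
    using assms by (simp_all add: sin_diff cos_diff sin_arctan cos_arctan)
qed

context oval_curve
begin

text \<open>The square of the sine, respectively hyperbolic sine, of the distance between
  \<open>\<Gamma> s\<close> and \<open>\<Gamma> t\<close>.\<close>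

definition R2 :: "real \<Rightarrow> real \<Rightarrow> real" where "R2 s t = (g s t)\<^sup>2 + (h s t)\<^sup>2"

lemma R2_commute: "R2 s t = R2 t s"
proof -
  have "curv S = curv S * (form S (\<Gamma> s) (\<Gamma> t))\<^sup>2 + (h s t)\<^sup>2 + (g s t)\<^sup>2" for s t
    using frame_pythagoras[OF frame[of s], of "\<Gamma> t"] by (simp add: form_\<Gamma>\<Gamma> g_def h_def)
  from this[of s t] this[of t s] show ?thesis
    by (simp add: R2_def form_commute[of S "\<Gamma> t"])
qed

lemma R2_pos: "\<Gamma> s \<noteq> \<Gamma> t \<Longrightarrow> 0 < R2 s t"
  using g_pos[of s t] by (simp add: R2_def add_pos_nonneg)

text \<open>The angle at \<open>\<Gamma> s\<close> between \<open>\<Gamma>' s\<close> and the geodesic from \<open>\<Gamma> s\<close> to \<open>\<Gamma> t\<close>.\<close>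

definition \<alpha> :: "real \<Rightarrow> real \<Rightarrow> real" where "\<alpha> s t = pi / 2 - arctan (h s t / g s t)"

lemma \<alpha>_bounds: "0 < \<alpha> s t" "\<alpha> s t < pi"
  using arctan_bounded[of "h s t / g s t"] by (auto simp: \<alpha>_def)

lemma sin_\<alpha>: "\<Gamma> s \<noteq> \<Gamma> t \<Longrightarrow> sin (\<alpha> s t) = g s t / sqrt (R2 s t)"
  and cos_\<alpha>: "\<Gamma> s \<noteq> \<Gamma> t \<Longrightarrow> cos (\<alpha> s t) = h s t / sqrt (R2 s t)"
  unfolding \<alpha>_def R2_def by (simp_all add: sin_arccot g_pos)

lemma \<alpha>_eqI:
  assumes "\<Gamma> s \<noteq> \<Gamma> t" "0 < \<psi>" "\<psi> < pi" "cos \<psi> * g s t = sin \<psi> * h s t"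
  shows "\<alpha> s t = \<psi>"
  unfolding \<alpha>_def by (rule arccot_eqI[OF assms(2,3) g_pos[OF assms(1)] assms(4)])

lemma \<alpha>_cong: "\<Gamma> s = \<Gamma> s' \<Longrightarrow> V s = V s' \<Longrightarrow> \<Gamma> t = \<Gamma> t' \<Longrightarrow> \<alpha> s t = \<alpha> s' t'"
  by (simp add: \<alpha>_def g_def h_def)

lemma h_deriv: "((\<lambda>t. h s t) has_real_derivative form S (V s) (V t)) (at t within T)"
  using has_real_derivative_form[OF has_vector_derivative_const[of "V s"] 
      has_vector_derivative_at_within[OF \<Gamma>_deriv], of S t T]
  by (simp add: h_def[abs_def])

lemma g_deriv: "((\<lambda>t. g s t) has_real_derivative det3 (\<Gamma> s) (V s) (V t)) (at t within T)"
  using has_real_derivative_form[OF has_vector_derivative_const[of "normal S (\<Gamma> s) (V s)"]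
      has_vector_derivative_at_within[OF \<Gamma>_deriv], of S t T]
  by (simp add: g_def[abs_def] form_normal)

lemma \<alpha>_deriv:
  assumes "\<Gamma> s \<noteq> \<Gamma> t"
  shows "(\<alpha> s has_real_derivative g t s / R2 s t) (at t within T)"
proof -
  have g: "g s t \<noteq> 0" using g_pos[OF assms] by simp
  have "form S (V s) (V t) * g s t - h s t * det3 (\<Gamma> s) (V s) (V t) = - g t s"
    using form_det3_wedge[of S "V s" "V t" "\<Gamma> s" "\<Gamma> t"] by (simp add: g_def h_def frame)
  moreover have "0 < 1 + (h s t / g s t)\<^sup>2" by (simp add: add_pos_nonneg)
  moreover have "R2 s t = (g s t)\<^sup>2 * (1 + (h s t / g s t)\<^sup>2)"
    using g by (simp add: R2_def field_simps)
  ultimately show ?thesis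
    unfolding \<alpha>_def
    by (auto intro!: derivative_eq_intros h_deriv g_deriv simp: g power2_eq_square)
      (simp add: divide_simps g)
qed

lemma \<alpha>_mono:
  assumes "s < t" "t < t'" "t' < s + l"
  shows "\<alpha> s t < \<alpha> s t'"
proof (rule DERIV_pos_imp_increasing[OF assms(2)])
  fix x assume "t \<le> x" "x \<le> t'"
  then have "\<Gamma> s \<noteq> \<Gamma> x" using assms by (intro \<Gamma>_neq) auto
  then show "\<exists>y. (\<alpha> s has_real_derivative y) (at x) \<and> 0 < y"
    using \<alpha>_deriv g_pos[of x s] R2_pos by (metis divide_pos_pos)
qed

lemma \<alpha>_inj:
  assumes "s < t" "t < s + l" "s < t'" "t' < s + l" "\<alpha> s t = \<alpha> s t'"
  shows "t = t'"
  using \<alpha>_mono[of s t t'] \<alpha>_mono[of s t' t] assms by (cases t t' rule: linorder_cases) auto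

lemma \<alpha>_surj:
  assumes "0 < \<psi>" "\<psi> < pi"
  shows "\<exists>t. s < t \<and> t < s + l \<and> \<alpha> s t = \<psi>"
proof -
  \<comment> \<open>a positive multiple of \<open>sin (\<alpha> s t - \<psi>)\<close> inside the interval; it vanishes with negative
    slope at both ends\<close>
  define k where "k t = cos \<psi> * g s t - sin \<psi> * h s t" for t
  have k_deriv: "(k has_real_derivative
      cos \<psi> * det3 (\<Gamma> s) (V s) (V t) - sin \<psi> * form S (V s) (V t)) (at t)" for t
    unfolding k_def by (auto intro!: derivative_eq_intros h_deriv g_deriv)
  have sin: "0 < sin \<psi>" using assms by (intro sin_gt_zero)
  have k0: "k s = 0" "k (s + l) = 0"
    by (simp_all add: k_def g_def h_def \<Gamma>_periodic form_commute[of S "V s"] form_\<Gamma>V)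
  have "(k has_real_derivative - sin \<psi>) (at s)" "(k has_real_derivative - sin \<psi>) (at (s + l))"
    using k_deriv[of s] k_deriv[of "s + l"] by (simp_all add: V_periodic form_VV)
  with sin obtain d1 d2 where d: "0 < d1" "\<And>x. 0 < x \<Longrightarrow> x < d1 \<Longrightarrow> k (s + x) < 0"
    "0 < d2" "\<And>x. 0 < x \<Longrightarrow> x < d2 \<Longrightarrow> 0 < k (s + l - x)"
    using DERIV_neg_dec_right[of k "- sin \<psi>" s] DERIV_neg_dec_left[of k "- sin \<psi>" "s + l"] k0
    by auto
  define e where "e = min (min d1 d2) l / 3"
  have e: "0 < e" "e < d1" "e < d2" "2 * e < l" using d l_pos by (auto simp: e_def)
  have "\<exists>t\<ge>s + e. t \<le> s + l - e \<and> k t = 0"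
  proof (rule IVT')
    show "continuous_on {s + e..s + l - e} k"
      using k_deriv by (meson DERIV_isCont continuous_at_imp_continuous_on)
  qed (use d e in \<open>auto intro: less_imp_le\<close>)
  then obtain t where t: "s + e \<le> t" "t \<le> s + l - e" "k t = 0" by blast
  then have t: "s < t" "t < s + l" "k t = 0" using e by auto
  moreover have "\<alpha> s t = \<psi>"
    using assms t by (intro \<alpha>_eqI \<Gamma>_neq) (auto simp: k_def)
  ultimately show ?thesis by blast
qed

text \<open>Meaningful for \<open>0 < \<psi> < pi\<close> only.\<close>

definition \<sigma> :: "real \<Rightarrow> real \<Rightarrow> real" where
  "\<sigma> s \<psi> = (THE t. s < t \<and> t < s + l \<and> \<alpha> s t = \<psi>)"

lemma \<sigma>_eqI: "s < t \<Longrightarrow> t < s + l \<Longrightarrow> \<alpha> s t = \<psi> \<Longrightarrow> \<sigma> s \<psi> = t"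
  unfolding \<sigma>_def by (rule the_equality) (auto intro: \<alpha>_inj)

lemma \<sigma>:
  assumes "0 < \<psi>" "\<psi> < pi"
  shows "s < \<sigma> s \<psi>" "\<sigma> s \<psi> < s + l" "\<alpha> s (\<sigma> s \<psi>) = \<psi>"
  using \<alpha>_surj[OF assms, of s] \<sigma>_eqI by auto

section \<open>Smoothness of the angle and of the arrival parameter; the bounce relation\<close>

lemma open_strip: "open strip"
  unfolding strip_def by (intro open_Times) auto

lemma Ck_gh:
  shows "Ck_on (j - 1) UNIV (\<lambda>z. g (fst z) (snd z))" "Ck_on (j - 1) UNIV (\<lambda>z. h (fst z) (snd z))"
    and "continuous_on UNIV (\<lambda>z. g (fst z) (snd z))" "continuous_on UNIV (\<lambda>z. h (fst z) (snd z))"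
proof -
  have \<Gamma>1: "Ck_on (j - 1) UNIV \<Gamma>" using Ck_\<Gamma> by (rule Ck_on_le) simp
  have pr: "Ck_on (j - 1) UNIV (\<lambda>z::real \<times> real. fst z)" "Ck_on (j - 1) UNIV (\<lambda>z::real \<times> real. snd z)"
    by (rule Ck_on_bounded_linear[OF open_UNIV bounded_linear_fst]
        Ck_on_bounded_linear[OF open_UNIV bounded_linear_snd])+
  note c = Ck_on_compose[OF open_UNIV open_UNIV _ _ subset_UNIV]
  show 1: "Ck_on (j - 1) UNIV (\<lambda>z. g (fst z) (snd z))"
    unfolding g_def by (rule Ck_on_det3[OF open_UNIV c[OF pr(1) \<Gamma>1] c[OF pr(1) Ck_V] c[OF pr(2) \<Gamma>1]])
  show 2: "Ck_on (j - 1) UNIV (\<lambda>z. h (fst z) (snd z))"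
    unfolding h_def by (rule Ck_on_form[OF open_UNIV c[OF pr(1) Ck_V] c[OF pr(2) \<Gamma>1]])
  show "continuous_on UNIV (\<lambda>z. g (fst z) (snd z))" "continuous_on UNIV (\<lambda>z. h (fst z) (snd z))"
    using Ck_on_imp_continuous_on[OF 1] Ck_on_imp_continuous_on[OF 2] .
qed

lemma Ck_\<alpha>:
  assumes "open U" "\<And>z. z \<in> U \<Longrightarrow> \<Gamma> (fst z) \<noteq> \<Gamma> (snd z)"
  shows "Ck_on (j - 1) U (\<lambda>z. \<alpha> (fst z) (snd z))"
proof -
  have "Ck_on (j - 1) U (\<lambda>z. h (fst z) (snd z) / g (fst z) (snd z))"
    using g_pos[OF assms(2)]
    by (intro Ck_on_divide assms(1) Ck_on_subset[OF Ck_gh(1)] Ck_on_subset[OF Ck_gh(2)]) force+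
  then show ?thesis
    unfolding \<alpha>_def
    by (intro Ck_on_diff assms(1) Ck_on_const Ck_on_compose[OF assms(1) open_UNIV _ Ck_on_arctan]) auto
qed

lemma Ck_\<sigma>: "Ck_on (j - 1) strip (\<lambda>z. \<sigma> (fst z) (snd z))"
proof -
  obtain k where k: "j - 1 = Suc k" using j by (cases "j - 1") auto
  define U where "U = {z :: real \<times> real. fst z < snd z \<and> snd z < fst z + l}"
  have U: "open U"
    unfolding U_def by (intro open_Collect_conj open_Collect_less continuous_intros)
  have neq: "\<Gamma> (fst z) \<noteq> \<Gamma> (snd z)" if "z \<in> U" for z
    using that \<Gamma>_neq[of "fst z" "snd z"] by (auto simp: U_def)
  have C: "Ck_on (Suc k) U (\<lambda>z. \<alpha> (fst z) (snd z))"
    unfolding k[symmetric] by (rule Ck_\<alpha>[OF U neq])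
  show ?thesis
    unfolding k
  proof (rule Ck_on_fibre_inverse[OF U open_strip C])
    fix z :: "real \<times> real" assume z: "z \<in> U"
    let ?D = "frechet_derivative (\<lambda>z. \<alpha> (fst z) (snd z)) (at z)"
    have D: "((\<lambda>z. \<alpha> (fst z) (snd z)) has_derivative ?D) (at (fst z, snd z))"
      using C z unfolding Ck_on.simps(2) frechet_derivative_works prod.collapse by blast
    have "((\<lambda>t. (fst z, t)) has_derivative (\<lambda>v. (0, v))) (at (snd z))"
      by (auto intro!: derivative_eq_intros)
    from has_derivative_compose[OF this D]
    have "((\<lambda>t. \<alpha> (fst z) t) has_derivative (\<lambda>v. ?D (0, v))) (at (snd z))"
      by (simp only: fst_conv snd_conv)
    moreover have "((\<lambda>t. \<alpha> (fst z) t) has_derivative (*) (g (snd z) (fst z) / R2 (fst z) (snd z))) (at (snd z))"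
      using \<alpha>_deriv[OF neq[OF z]] by (simp add: has_field_derivative_def)
    ultimately have "(\<lambda>v. ?D (0, v)) = (*) (g (snd z) (fst z) / R2 (fst z) (snd z))"
      by (rule has_derivative_unique)
    from fun_cong[OF this, of 1] show "?D (0, 1) \<noteq> 0"
      using g_pos[OF neq[OF z, symmetric]] R2_pos[OF neq[OF z]] by simp
  next
    fix s \<psi> assume "(s, \<psi>) \<in> strip"
    then show "(s, \<sigma> (fst (s, \<psi>)) (snd (s, \<psi>))) \<in> U \<and>
      \<alpha> (fst (s, \<sigma> (fst (s, \<psi>)) (snd (s, \<psi>)))) (snd (s, \<sigma> (fst (s, \<psi>)) (snd (s, \<psi>)))) = \<psi>"
      using \<sigma> by (simp add: U_def strip_def)
  qed (simp add: U_def \<sigma>_eqI)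
qed

text \<open>The chord that leaves \<open>\<Gamma> s\<close> at the angle \<open>\<psi>\<close> is reflected at \<open>\<Gamma> t\<close> to the angle \<open>\<phi>\<close>; seen from
  \<open>\<Gamma> t\<close>, the chord back to \<open>\<Gamma> s\<close> makes the angle \<open>pi - \<phi>\<close> with the tangent.\<close>

definition bounce :: "real \<times> real \<Rightarrow> real \<times> real \<Rightarrow> bool" where
  "bounce = (\<lambda>(s, \<psi>) (t, \<phi>). \<Gamma> s \<noteq> \<Gamma> t \<and> \<alpha> s t = \<psi> \<and> \<alpha> t s = pi - \<phi>)"

text \<open>Traversing the chord backwards exchanges \<open>\<alpha> s t\<close> and
  \<open>\<alpha> t s\<close>. Reversibility and bijectivity both rest on this.\<close>

lemma bounce_reverse: "bounce p q \<longleftrightarrow> bounce (angle_reversal q) (angle_reversal p)"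
  by (auto simp: bounce_def angle_reversal_def)

text \<open>The lift to the covering strip: the arrival parameter is kept between \<open>s\<close>
  and \<open>s + l\<close> and is thus smooth also where its reduction modulo \<open>l\<close>
  jumps.\<close>

definition next_bounce :: "real \<times> real \<Rightarrow> real \<times> real" where
  "next_bounce = (\<lambda>(s, \<psi>). (\<sigma> s \<psi>, pi - \<alpha> (\<sigma> s \<psi>) s))"

lemma next_bounce_strip: "z \<in> strip \<Longrightarrow> next_bounce z \<in> strip"
  using \<alpha>_bounds by (auto simp: next_bounce_def strip_def)

lemma cyl_proj_in: "z \<in> strip \<Longrightarrow> cyl_proj l z \<in> cylinder l"
  using l_pos by (auto simp: cyl_proj_def strip_def cylinder_def rmod_nonneg rmod_less)

text \<open>An arrival parameter in \<open>{0..<l}\<close> is shifted by a multiple of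
  \<open>l\<close> to lie between \<open>s\<close> and \<open>s + l\<close>, where
  \<open>\<sigma> s \<psi>\<close> is the only solution.\<close>

lemma bounce_iff:
  assumes "z \<in> strip" "q \<in> cylinder l"
  shows "bounce (cyl_proj l z) q \<longleftrightarrow> q = cyl_proj l (next_bounce z)"
proof -
  obtain s \<psi> t \<phi> where [simp]: "z = (s, \<psi>)" "q = (t, \<phi>)" by (cases z, cases q)
  have \<psi>: "0 < \<psi>" "\<psi> < pi" and t: "0 \<le> t" "t < l"
    using assms by (auto simp: strip_def cylinder_def)
  have rs: "\<alpha> (s rmod l) x = \<alpha> s x" "\<alpha> x (s rmod l) = \<alpha> x s" for s x
    by (rule \<alpha>_cong; simp add: \<Gamma>_rmod V_rmod)+
  show ?thesis
  proof
    assume "bounce (cyl_proj l z) q"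
    then have b: "\<Gamma> s \<noteq> \<Gamma> t" "\<alpha> s t = \<psi>" "\<alpha> t s = pi - \<phi>"
      by (auto simp: bounce_def cyl_proj_def \<Gamma>_rmod rs)
    define d where "d = (t - s) rmod l"
    have eq: "s + d = t + of_int (- \<lfloor>(t - s) / l\<rfloor>) * l"
      by (simp add: d_def rmod_eq[OF l_pos])
    have \<Gamma>d: "\<Gamma> (s + d) = \<Gamma> t" unfolding eq by (rule \<Gamma>_shift)
    then have "d \<noteq> 0" using b by auto
    moreover have "0 \<le> d" "d < l" using l_pos by (auto simp: d_def rmod_nonneg rmod_less)
    ultimately have "\<sigma> s \<psi> = s + d"
      using b \<alpha>_cong[OF refl refl \<Gamma>d, of s] by (intro \<sigma>_eqI) auto
    moreover have "(s + d) rmod l = t"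
    proof (rule rmod_unique)
      show "s + d = t + of_int (- \<lfloor>(t - s) / l\<rfloor>) * l" by (rule eq)
    qed (use t in auto)
    ultimately have "\<sigma> s \<psi> rmod l = t" by simp
    then show "q = cyl_proj l (next_bounce z)"
      using b rs by (auto simp: cyl_proj_def next_bounce_def)
  next
    assume "q = cyl_proj l (next_bounce z)"
    then show "bounce (cyl_proj l z) q"
      using \<sigma>[OF \<psi>, of s] \<Gamma>_neq[of s "\<sigma> s \<psi>"]
      by (auto simp: bounce_def cyl_proj_def next_bounce_def \<Gamma>_rmod rs)
  qed
qed

lemma cyl_proj_id: "z \<in> cylinder l \<Longrightarrow> cyl_proj l z = z"
  using l_pos by (auto simp: cyl_proj_def cylinder_def)

lemma cylinder_strip: "z \<in> cylinder l \<Longrightarrow> z \<in> strip"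
  by (auto simp: cylinder_def strip_def)

lemma bounce_cyl_iff:
  "p \<in> cylinder l \<Longrightarrow> q \<in> cylinder l \<Longrightarrow> bounce p q \<longleftrightarrow> q = cyl_proj l (next_bounce p)"
  using bounce_iff[OF cylinder_strip] by (simp add: cyl_proj_id)

lemma angle_reversal_strip: "z \<in> strip \<Longrightarrow> angle_reversal z \<in> strip"
  by (auto simp: strip_def angle_reversal_def)

lemma angle_reversal_cylinder: "z \<in> cylinder l \<Longrightarrow> angle_reversal z \<in> cylinder l"
  by (auto simp: cylinder_def angle_reversal_def)

lemma angle_reversal_involution [simp]: "angle_reversal (angle_reversal z) = z"
  by (auto simp: angle_reversal_def split: prod.splits)

lemma angle_reversal_cyl_proj: "angle_reversal (cyl_proj l z) = cyl_proj l (angle_reversal z)"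
  by (auto simp: angle_reversal_def cyl_proj_def split: prod.splits)

lemma Ck_next_bounce: "Ck_on (j - 1) strip next_bounce"
proof -
  define U where "U = {z :: real \<times> real. \<Gamma> (fst z) \<noteq> \<Gamma> (snd z)}"
  have "continuous_on UNIV \<Gamma>" using Ck_on_imp_continuous_on[OF Ck_\<Gamma>] .
  note c = continuous_on_compose2[OF this _ subset_UNIV]
  have U: "open U"
    unfolding U_def
    by (rule open_Collect_neq[OF c[OF continuous_on_fst[OF continuous_on_id]]
          c[OF continuous_on_snd[OF continuous_on_id]]])
  have fst: "Ck_on (j - 1) strip (\<lambda>z::real \<times> real. fst z)"
    by (rule Ck_on_bounded_linear[OF open_strip bounded_linear_fst])
  have pair: "Ck_on (j - 1) strip (\<lambda>z. (\<sigma> (fst z) (snd z), fst z))"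
    by (rule Ck_on_Pair[OF open_strip Ck_\<sigma> fst])
  have "(\<sigma> (fst z) (snd z), fst z) \<in> U" if "z \<in> strip" for z
    using that \<sigma>[of "snd z" "fst z"] \<Gamma>_neq[of "fst z" "\<sigma> (fst z) (snd z)"]
    by (auto simp: U_def strip_def)
  then have sub: "(\<lambda>z. (\<sigma> (fst z) (snd z), fst z)) ` strip \<subseteq> U" by blast
  have "Ck_on (j - 1) U (\<lambda>z. \<alpha> (fst z) (snd z))"
    by (rule Ck_\<alpha>[OF U]) (simp add: U_def)
  from Ck_on_compose[OF open_strip U pair this sub]
  have "Ck_on (j - 1) strip (\<lambda>z. \<alpha> (\<sigma> (fst z) (snd z)) (fst z))"
    by (simp only: fst_conv snd_conv)
  from Ck_on_Pair[OF open_strip Ck_\<sigma> Ck_on_diff[OF open_strip Ck_on_const[OF open_strip] this]]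
  have "Ck_on (j - 1) strip (\<lambda>z. (\<sigma> (fst z) (snd z), pi - \<alpha> (\<sigma> (fst z) (snd z)) (fst z)))" .
  then show ?thesis by (simp add: next_bounce_def case_prod_unfold)
qed

end

section \<open>The region bounded by the curve\<close>

lemma continuous_on_nth:
  fixes f :: "'a::t2_space \<Rightarrow> real ^ 3"
  shows "continuous_on T f \<Longrightarrow> continuous_on T (\<lambda>x. f x $ i)"
  by (rule bounded_linear.continuous_on[OF bounded_linear_vec_nth])

lemma point_eqI:
  assumes "Y = c *\<^sub>R X" "X \<in> points S" "Y \<in> points S"
  shows "Y = X"
proof -
  have "curv S = c * c * curv S"
    using assms(2,3) unfolding assms(1) by (simp add: points_iff form_linear)
  then have "c\<^sup>2 = 1" by (simp add: power2_eq_square)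
  moreover have "0 < c"
    using assms(2,3) unfolding assms(1) by (simp add: points_iff zero_less_mult_iff)
  ultimately have "c = 1" by (simp add: power2_eq_1_iff)
  then show ?thesis using assms(1) by simp
qed

lemma closed_form_level:
  "closed {Y. form S Y Y = curv S \<and> 0 \<le> Y $ 3 \<and> (Y $ 1)\<^sup>2 + (Y $ 2)\<^sup>2 \<le> r * (Y $ 3)\<^sup>2}"
  unfolding form_eq
  by (intro closed_Collect_conj closed_Collect_eq closed_Collect_le continuous_intros
      bounded_linear.continuous_on[OF bounded_linear_vec_nth])

text \<open>In the chart \<open>(x/z, y/z)\<close> the hemisphere is the whole plane but the
  hyperbolic plane only the open unit disc, whence the bound on \<open>r\<close>. The weak
  inequality \<open>0 \<le> Y $ 3\<close> keeps the set closed; equality would force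
  \<open>Y = 0\<close>.\<close>

lemma compact_cone_section:
  assumes "S = Hyperbolic_Plane \<Longrightarrow> r < 1"
  defines "K \<equiv> {Y. form S Y Y = curv S \<and> 0 \<le> Y $ 3 \<and> (Y $ 1)\<^sup>2 + (Y $ 2)\<^sup>2 \<le> r * (Y $ 3)\<^sup>2}"
  shows "compact K" "K \<subseteq> points S"
proof -
  show "K \<subseteq> points S"
  proof
    fix Y assume Y: "Y \<in> K"
    have "Y $ 3 \<noteq> 0"
    proof
      assume "Y $ 3 = 0"
      moreover then have "Y $ 1 = 0" "Y $ 2 = 0"
        using Y by (auto simp: K_def sum_power2_le_zero_iff)
      ultimately show False using Y by (simp add: K_def form_eq)
    qed
    then show "Y \<in> points S" using Y by (simp add: K_def points_iff)
  qed
  have "bounded K"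
  proof (cases S)
    case Hemisphere
    then have "norm Y = 1" if "Y \<in> K" for Y
      using that by (simp add: K_def norm_eq_1)
    then show ?thesis by (metis bounded_iff order_refl)
  next
    case Hyperbolic_Plane
    have "norm Y \<le> 3 * sqrt (1 / (1 - r))" if "Y \<in> K" for Y
    proof -
      have 1: "(Y $ 3)\<^sup>2 = 1 + (Y $ 1)\<^sup>2 + (Y $ 2)\<^sup>2" "(Y $ 1)\<^sup>2 + (Y $ 2)\<^sup>2 \<le> r * (Y $ 3)\<^sup>2"
        using that Hyperbolic_Plane by (auto simp: K_def form_eq power2_eq_square)
      then have "(Y $ 3)\<^sup>2 * (1 - r) \<le> 1" by (simp add: algebra_simps)
      then have 2: "(Y $ 3)\<^sup>2 \<le> 1 / (1 - r)"
        using assms(1)[OF Hyperbolic_Plane] by (simp add: field_simps)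
      moreover have "(Y $ 1)\<^sup>2 \<le> 1 / (1 - r)" "(Y $ 2)\<^sup>2 \<le> 1 / (1 - r)"
        using 1(1) 2 zero_le_power2[of "Y $ 1"] zero_le_power2[of "Y $ 2"] by linarith+
      ultimately have "(Y $ i)\<^sup>2 \<le> 1 / (1 - r)" for i
        using exhaust_3[of i] by auto
      then have b: "\<bar>Y $ i\<bar> \<le> sqrt (1 / (1 - r))" for i
        by (metis real_sqrt_abs real_sqrt_le_mono)
      have "(\<Sum>i\<in>UNIV. \<bar>Y $ i\<bar>) \<le> 3 * sqrt (1 / (1 - r))"
        unfolding sum_3 using b[of 1] b[of 2] b[of 3] by linarith
      then show ?thesis using norm_le_l1_cart[of Y] by simp
    qed
    then show ?thesis by (metis bounded_iff)
  qed
  moreover have "closed K" unfolding K_def by (rule closed_form_level)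
  ultimately show "compact K" by (simp add: compact_eq_bounded_closed)
qed

context oval_curve
begin

lemma continuous_\<Gamma>: "continuous_on T \<Gamma>" and continuous_V: "continuous_on T V"
  using Ck_on_imp_continuous_on[OF Ck_\<Gamma>] Ck_on_imp_continuous_on[OF Ck_V]
  by (auto intro: continuous_on_subset)

text \<open>At \<open>s\<close> the determinant is minimal as a function of the parameter, so its
  derivative vanishes. By positive curvature this kills the component of \<open>Y\<close> along
  \<open>V s\<close> and leaves a multiple of \<open>\<Gamma> s\<close>.\<close>

lemma tangent_touching:
  assumes "Y \<in> points S" "\<And>s. 0 \<le> det3 (\<Gamma> s) (V s) Y" "det3 (\<Gamma> s) (V s) Y = 0"
  shows "Y = \<Gamma> s"
proof -
  have d: "((\<lambda>s. det3 (\<Gamma> s) (V s) Y) has_real_derivative det3 (\<Gamma> s) (A s) Y) (at s)"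
    unfolding det3_def
    by (rule derivative_eq_intros has_real_derivative_nth[OF \<Gamma>_deriv]
        has_real_derivative_nth[OF V_deriv] refl)+ (simp add: algebra_simps)
  have "det3 (\<Gamma> s) (A s) Y = 0"
    by (rule DERIV_local_min[OF d, of 1]) (use assms(2,3) in auto)
  moreover have Y: "Y = (curv S * form S (\<Gamma> s) Y) *\<^sub>R \<Gamma> s + form S (V s) Y *\<^sub>R V s"
    using frame_expansion(1)[OF frame[of s], of Y] assms(3) by simp
  have "det3 (\<Gamma> s) (A s) Y = form S (V s) Y * det3 (\<Gamma> s) (A s) (V s)"
    by (subst Y) (simp add: det3_linear)
  moreover have "det3 (\<Gamma> s) (A s) (V s) = - det3 (\<Gamma> s) (V s) (A s)"
    by (simp add: det3_def algebra_simps)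
  ultimately have "form S (V s) Y = 0" using det3_A[of s] by simp
  then have "Y = (curv S * form S (\<Gamma> s) Y) *\<^sub>R \<Gamma> s" using Y by simp
  then show ?thesis by (rule point_eqI) (use assms(1) range_\<Gamma> in auto)
qed

text \<open>In the affine chart \<open>(x/z, y/z)\<close> a point \<open>y\<close> in all the half-planes bounded by tangents of the
  curve satisfies \<open>y \<bullet> y \<le> y \<bullet> p\<close> for the point \<open>p\<close> of the curve that is extremal in
  the direction \<open>y\<close>.\<close>

lemma half_planes_bounded:
  assumes "0 < Y $ 3" "\<And>s. 0 \<le> det3 (\<Gamma> s) (V s) Y"
    "\<And>s. (\<Gamma> s $ 1)\<^sup>2 + (\<Gamma> s $ 2)\<^sup>2 \<le> r * (\<Gamma> s $ 3)\<^sup>2"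
  shows "(Y $ 1)\<^sup>2 + (Y $ 2)\<^sup>2 \<le> r * (Y $ 3)\<^sup>2"
proof -
  define y1 where "y1 = Y $ 1 / Y $ 3"
  define y2 where "y2 = Y $ 2 / Y $ 3"
  define p1 where "p1 s = \<Gamma> s $ 1 / \<Gamma> s $ 3" for s
  define p2 where "p2 s = \<Gamma> s $ 2 / \<Gamma> s $ 3" for s
  define f where "f s = y1 * p1 s + y2 * p2 s" for s
  define n where "n i s = V s $ i * \<Gamma> s $ 3 - \<Gamma> s $ i * V s $ 3" for i s
  have nz: "\<Gamma> s $ 3 \<noteq> 0" for s using \<Gamma>_3[of s] by simp
  have pbound: "(p1 s)\<^sup>2 + (p2 s)\<^sup>2 \<le> r" for s
    using assms(3)[of s] nz[of s] by (simp add: p1_def p2_def power_divide field_simps)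
  have det: "det3 (\<Gamma> s) (V s) Z = Z $ 3 * (n 1 s * (Z $ 2 / Z $ 3 - p2 s) - n 2 s * (Z $ 1 / Z $ 3 - p1 s))"
    if "Z $ 3 \<noteq> 0" for s Z
    using nz[of s] that by (simp add: n_def det3_def p1_def p2_def field_simps)
  have "continuous_on {0..l} f"
    unfolding f_def p1_def p2_def
    by (intro continuous_intros continuous_on_nth continuous_\<Gamma>) (simp_all add: nz)
  then obtain a where a: "\<forall>s\<in>{0..l}. f s \<le> f a"
    using continuous_attains_sup[of "{0..l}" f] l_pos by auto
  have a: "f s \<le> f a" for s
  proof -
    have "f (s rmod l) = f s" by (simp add: f_def p1_def p2_def \<Gamma>_rmod)
    moreover have "s rmod l \<in> {0..l}" using l_pos by (auto simp: rmod_nonneg rmod_le)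
    ultimately show ?thesis using a by metis
  qed
  have "(f has_real_derivative (y1 * n 1 a + y2 * n 2 a) / (\<Gamma> a $ 3)\<^sup>2) (at a)"
    unfolding f_def p1_def p2_def
    by (rule derivative_eq_intros has_real_derivative_nth[OF \<Gamma>_deriv] nz refl)+
      (use nz[of a] in \<open>simp add: n_def field_simps power2_eq_square\<close>)
  then have "(y1 * n 1 a + y2 * n 2 a) / (\<Gamma> a $ 3)\<^sup>2 = 0"
    by (rule DERIV_local_max[of f _ a 1]) (use a in auto)
  then have orth: "y1 * n 1 a + y2 * n 2 a = 0" using nz by simp
  define q where "q = y1\<^sup>2 + y2\<^sup>2"
  define \<nu> where "\<nu> = y1 * n 2 a - y2 * n 1 a"
  \<comment> \<open>\<open>n\<close> at \<open>a\<close> is orthogonal to \<open>(y1, y2)\<close>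
    because \<open>f\<close> is maximal there; so its determinant with any vector is a fixed
    multiple of the inner product of \<open>(y1, y2)\<close> with that vector.\<close>
  have cross: "q * (n 1 a * x2 - n 2 a * x1) = - \<nu> * (y1 * x1 + y2 * x2)" for x1 x2
  proof -
    have "q * (n 1 a * x2 - n 2 a * x1) + \<nu> * (y1 * x1 + y2 * x2)
      = (y1 * n 1 a + y2 * n 2 a) * (y1 * x2 - y2 * x1)"
      by (simp add: q_def \<nu>_def power2_eq_square algebra_simps)
    then show ?thesis using orth by simp
  qed
  have "q \<le> r"
  proof (cases "q = 0")
    case True
    then show ?thesis using pbound[of 0] by (smt (verit) zero_le_power2)
  next
    case False
    then have q: "0 < q" by (simp add: q_def less_le)
    \<comment> \<open>Any other point of the curve would serve: it lies on the inner side of the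
      tangent at \<open>a\<close> and so fixes the sign of \<open>\<nu>\<close>.\<close>
    let ?t = "a + l / 2"
    have "0 < g a ?t" by (rule g_pos_interval) (use l_pos in auto)
    then have "0 < n 1 a * (p2 ?t - p2 a) - n 2 a * (p1 ?t - p1 a)"
      using det[of "\<Gamma> ?t" a] nz[of ?t] \<Gamma>_3[of ?t] by (simp add: g_def p1_def p2_def zero_less_mult_iff)
    then have "0 < - \<nu> * (y1 * (p1 ?t - p1 a) + y2 * (p2 ?t - p2 a))"
      using q unfolding cross[symmetric] by simp
    then have "0 < - \<nu> * (f ?t - f a)" by (simp add: f_def algebra_simps)
    then have \<nu>: "0 < \<nu>" using a[of ?t] by (auto simp: zero_less_mult_iff mult_less_0_iff)
    have "0 \<le> n 1 a * (y2 - p2 a) - n 2 a * (y1 - p1 a)"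
      using assms(2)[of a] det[of Y a] assms(1) by (simp add: y1_def y2_def zero_le_mult_iff)
    then have "0 \<le> - \<nu> * (y1 * (y1 - p1 a) + y2 * (y2 - p2 a))"
      using q unfolding cross[symmetric] by simp
    then have "y1 * (y1 - p1 a) + y2 * (y2 - p2 a) \<le> 0"
      using \<nu> by (auto simp: zero_le_mult_iff mult_le_0_iff)
    then have "q \<le> y1 * p1 a + y2 * p2 a" by (simp add: q_def power2_eq_square algebra_simps)
    moreover have "2 * (y1 * p1 a + y2 * p2 a) \<le> q + ((p1 a)\<^sup>2 + (p2 a)\<^sup>2)"
      using zero_le_power2[of "y1 - p1 a"] zero_le_power2[of "y2 - p2 a"]
      by (simp add: q_def power2_diff)
    ultimately show ?thesis using pbound[of a] by simp
  qed
  then show ?thesis using assms(1) by (simp add: q_def y1_def y2_def power_divide field_simps)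
qed

lemma compact_half_planes:
  "\<exists>K. compact K \<and> K \<subseteq> points S \<and> {Y \<in> points S. \<forall>s. 0 \<le> det3 (\<Gamma> s) (V s) Y} \<subseteq> K"
proof -
  define \<rho> where "\<rho> s = ((\<Gamma> s $ 1)\<^sup>2 + (\<Gamma> s $ 2)\<^sup>2) / (\<Gamma> s $ 3)\<^sup>2" for s
  have nz: "\<Gamma> s $ 3 \<noteq> 0" for s using \<Gamma>_3[of s] by simp
  have "continuous_on {0..l} \<rho>"
    unfolding \<rho>_def by (intro continuous_intros continuous_on_nth continuous_\<Gamma>) (simp_all add: nz)
  then obtain a where a: "\<forall>s\<in>{0..l}. \<rho> s \<le> \<rho> a"
    using continuous_attains_sup[of "{0..l}" \<rho>] l_pos by auto
  have a: "\<rho> s \<le> \<rho> a" for s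
  proof -
    have "\<rho> (s rmod l) = \<rho> s" by (simp add: \<rho>_def \<Gamma>_rmod)
    moreover have "s rmod l \<in> {0..l}" using l_pos by (auto simp: rmod_nonneg rmod_le)
    ultimately show ?thesis using a by metis
  qed
  have bound: "(\<Gamma> s $ 1)\<^sup>2 + (\<Gamma> s $ 2)\<^sup>2 \<le> \<rho> a * (\<Gamma> s $ 3)\<^sup>2" for s
    using a[of s] nz[of s] by (simp add: \<rho>_def[of s] field_simps)
  have less: "\<rho> a < 1" if "S = Hyperbolic_Plane"
  proof -
    have "(\<Gamma> a $ 1)\<^sup>2 + (\<Gamma> a $ 2)\<^sup>2 < (\<Gamma> a $ 3)\<^sup>2"
      using form_\<Gamma>\<Gamma>[of a] that by (simp add: form_eq power2_eq_square)
    then show ?thesis using nz[of a] by (simp add: \<rho>_def field_simps)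
  qed
  show ?thesis
    using compact_cone_section[OF less] half_planes_bounded[OF _ _ bound]
    by (intro exI[of _ "{Y. form S Y Y = curv S \<and> 0 \<le> Y $ 3 \<and>
          (Y $ 1)\<^sup>2 + (Y $ 2)\<^sup>2 \<le> \<rho> a * (Y $ 3)\<^sup>2}"])
      (auto simp: points_iff less_imp_le)
qed

text \<open>The sets \<open>F\<close> (weakly inside every tangent) and \<open>G\<close> (weakly
  outside some tangent) are closed and cover the space; on the surface they meet only on the curve,
  by \<open>tangent_touching\<close>. Hence the component of \<open>Z\<close> stays in
  \<open>F\<close>, whose part on the surface lies in a compact set.\<close>

lemma region_half_planes:
  assumes "Z \<in> points S" "\<And>s. 0 < det3 (\<Gamma> s) (V s) Z"
  shows "Z \<in> region S \<Gamma>"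
proof -
  let ?C = "connected_component_set (points S - range \<Gamma>) Z"
  define F where "F = {Y. \<forall>s. 0 \<le> det3 (\<Gamma> s) (V s) Y}"
  \<comment> \<open>One compact period of parameters, so that the projection \<open>G\<close> of a
    closed set is closed.\<close>
  define G where "G = {Y. \<exists>s\<in>{0..l}. det3 (\<Gamma> s) (V s) Y \<le> 0}"
  have Z: "Z \<in> points S - range \<Gamma>"
    using assms by (metis DiffI det3_same(1) imageE less_irrefl)
  have C: "?C \<subseteq> points S - range \<Gamma>" by (rule connected_component_subset)
  have "closed F"
    unfolding F_def det3_def
    by (intro closed_Collect_all closed_Collect_le continuous_intros continuous_on_nth)
  moreover have "closed G"
  proof -
    let ?U = "{z. fst z \<in> {0..l} \<and> det3 (\<Gamma> (fst z)) (V (fst z)) (snd z) \<le> 0}"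
    have "closed ?U"
      unfolding det3_def atLeastAtMost_iff
      by (intro closed_Collect_conj closed_Collect_le continuous_intros continuous_on_nth
          continuous_on_compose2[OF continuous_\<Gamma>[of UNIV]]
          continuous_on_compose2[OF continuous_V[of UNIV]]) auto
    then have "closedin (top_of_set ({0..l} \<times> UNIV)) ?U"
      by (intro closed_subset) auto
    from closedin_compact_projection[OF compact_Icc this]
    have "closed {y. \<exists>x. x \<in> {0..l} \<and> (x, y) \<in> ?U}" by simp
    moreover have "{y. \<exists>x. x \<in> {0..l} \<and> (x, y) \<in> ?U} = G" by (auto simp: G_def)
    ultimately show ?thesis by argo
  qed
  moreover have cover: "Y \<in> F \<union> G" for Y
  proof (rule ccontr)
    assume "Y \<notin> F \<union> G"
    then obtain s where s: "det3 (\<Gamma> s) (V s) Y < 0" "Y \<notin> G" by (auto simp: F_def not_le)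
    have "s rmod l \<in> {0..l}" using l_pos by (auto simp: rmod_nonneg rmod_le)
    moreover have "det3 (\<Gamma> (s rmod l)) (V (s rmod l)) Y < 0" using s by (simp add: \<Gamma>_rmod V_rmod)
    ultimately have "Y \<in> G"
      unfolding G_def by (intro CollectI bexI[of _ "s rmod l"]) (rule less_imp_le)
    then show False using s by simp
  qed
  moreover have "F \<inter> G \<inter> ?C = {}"
  proof (rule ccontr)
    assume "\<not> ?thesis"
    then obtain Y s where Y: "Y \<in> points S" "Y \<notin> range \<Gamma>" "Y \<in> F" "det3 (\<Gamma> s) (V s) Y \<le> 0"
      using C by (auto simp: G_def)
    then show False using tangent_touching[of Y s] by (auto simp: F_def order.antisym)
  qed
  moreover have "Z \<in> ?C" using Z by simp
  moreover have "Z \<in> F" using assms by (auto simp: F_def less_imp_le)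
  ultimately have "G \<inter> ?C = {}"
    using connected_connected_component[of "points S - range \<Gamma>" Z, unfolded connected_closed] by blast
  then have "?C \<subseteq> F" using cover by blast
  with C have "?C \<subseteq> {Y \<in> points S. \<forall>s. 0 \<le> det3 (\<Gamma> s) (V s) Y}"
    unfolding F_def by blast
  moreover obtain K where "compact K" "K \<subseteq> points S"
    "{Y \<in> points S. \<forall>s. 0 \<le> det3 (\<Gamma> s) (V s) Y} \<subseteq> K"
    using compact_half_planes by blast
  ultimately show ?thesis
    unfolding region_def
    by (intro CollectI conjI exI[of _ K] Z) (assumption | erule (1) subset_trans)+
qed

text \<open>Both endpoints lie weakly inside every tangent, and no tangent contains both of
  them.\<close>

lemma chord_in_region:
  assumes "\<Gamma> s \<noteq> \<Gamma> t" "0 < a" "0 < b" "a *\<^sub>R \<Gamma> s + b *\<^sub>R \<Gamma> t \<in> points S"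
  shows "a *\<^sub>R \<Gamma> s + b *\<^sub>R \<Gamma> t \<in> region S \<Gamma>"
proof (rule region_half_planes[OF assms(4)])
  fix x
  have nonneg: "0 \<le> g x y" for y
  proof (cases "\<Gamma> x = \<Gamma> y")
    case True
    then show ?thesis by (simp add: g_def)
  qed (use g_pos[of x y] in simp)
  have "0 < g x s \<or> 0 < g x t" using assms(1) g_pos by metis
  then have "0 < a * g x s + b * g x t"
    using nonneg[of s] nonneg[of t] assms(2,3) by (auto intro: add_pos_nonneg add_nonneg_pos)
  then show "0 < det3 (\<Gamma> x) (V x) (a *\<^sub>R \<Gamma> s + b *\<^sub>R \<Gamma> t)"
    by (simp add: det3_linear g_def)
qed

end

section \<open>Geodesics\<close>

text \<open>\<open>Cs\<close> and \<open>Sn\<close> solve f'' = - \<open>curv S\<close> f with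
  initial values 1, 0 and slopes 0, 1.\<close>

definition Cs :: "surface \<Rightarrow> real \<Rightarrow> real" where
  "Cs S t = (case S of Hemisphere \<Rightarrow> cos t | Hyperbolic_Plane \<Rightarrow> cosh t)"

definition Sn :: "surface \<Rightarrow> real \<Rightarrow> real" where
  "Sn S t = (case S of Hemisphere \<Rightarrow> sin t | Hyperbolic_Plane \<Rightarrow> sinh t)"

lemma Cs_Sn_0 [simp]: "Cs S 0 = 1" "Sn S 0 = 0"
  by (cases S; simp add: Cs_def Sn_def)+

lemma Cs_Sn_pythagoras: "Cs S t * Cs S t + curv S * (Sn S t * Sn S t) = 1"
  using cosh_square_eq[of t]
  by (cases S) (simp_all add: Cs_def Sn_def power2_eq_square[symmetric])

lemma Cs_deriv: "(Cs S has_real_derivative - curv S * Sn S t) (at t within T)"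
  by (cases S) (auto intro!: derivative_eq_intros simp: Cs_def[abs_def] Sn_def)

lemma Sn_deriv: "(Sn S has_real_derivative Cs S t) (at t within T)"
  by (cases S) (auto intro!: derivative_eq_intros simp: Cs_def Sn_def[abs_def])

lemma Sn_diff: "Sn S (x - y) = Sn S x * Cs S y - Cs S x * Sn S y"
  by (cases S) (simp_all add: Cs_def Sn_def sin_diff sinh_diff)

definition geo :: "surface \<Rightarrow> real ^ 3 \<Rightarrow> real ^ 3 \<Rightarrow> real \<Rightarrow> real ^ 3" where
  "geo S X u t = Cs S t *\<^sub>R X + Sn S t *\<^sub>R u"

definition geo_velocity :: "surface \<Rightarrow> real ^ 3 \<Rightarrow> real ^ 3 \<Rightarrow> real \<Rightarrow> real ^ 3" where
  "geo_velocity S X u t = (- curv S * Sn S t) *\<^sub>R X + Cs S t *\<^sub>R u"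

lemma geo_0 [simp]: "geo S X u 0 = X" "geo_velocity S X u 0 = u"
  by (simp_all add: geo_def geo_velocity_def)

lemma geo_deriv: "(geo S X u has_vector_derivative geo_velocity S X u t) (at t within T)"
  unfolding geo_def geo_velocity_def
  by (intro has_vector_derivative_add has_vector_derivative_scaleR[where g' = 0, simplified]
      Cs_deriv Sn_deriv has_vector_derivative_const)

lemma geo_velocity_deriv:
  "(geo_velocity S X u has_vector_derivative (- curv S) *\<^sub>R geo S X u t) (at t within T)"
proof -
  have "(geo_velocity S X u has_vector_derivative
      (- curv S * Cs S t) *\<^sub>R X + (- curv S * Sn S t) *\<^sub>R u) (at t within T)"
    unfolding geo_velocity_def
    by (intro has_vector_derivative_add has_vector_derivative_scaleR[where g' = 0, simplified]
        DERIV_cmult Cs_deriv Sn_deriv has_vector_derivative_const)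
  then show ?thesis by (simp add: geo_def scaleR_add_right)
qed

lemma geo_reverse: "X = Cs S t *\<^sub>R geo S X u t - Sn S t *\<^sub>R geo_velocity S X u t"
proof -
  have "Cs S t *\<^sub>R geo S X u t - Sn S t *\<^sub>R geo_velocity S X u t
      = (Cs S t * Cs S t + curv S * (Sn S t * Sn S t)) *\<^sub>R X"
    by (simp add: geo_def geo_velocity_def algebra_simps)
  then show ?thesis by (simp add: Cs_Sn_pythagoras)
qed

lemma form_geo:
  assumes "form S X X = curv S" "form S X u = 0" "form S u u = 1"
  shows "form S (geo S X u t) (geo S X u t) = curv S"
proof -
  have "form S (geo S X u t) (geo S X u t) =
      curv S * (Cs S t * Cs S t + curv S * (Sn S t * Sn S t))"
    using assms by (simp add: geo_def form_linear form_commute[of S u X] algebra_simps)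
  then show ?thesis by (simp add: Cs_Sn_pythagoras)
qed

lemma geodesic_on_geo:
  assumes "form S X X = curv S" "form S X u = 0" "form S u u = 1"
    "\<And>t. t \<in> J \<Longrightarrow> 0 < geo S X u t $ 3"
  shows "geodesic_on S J (geo S X u)"
  unfolding geodesic_on_def
proof (intro conjI exI[of _ "geo_velocity S X u"] ballI)
  show "geo S X u ` J \<subseteq> points S"
    using form_geo[OF assms(1-3)] assms(4) by (auto simp: points_iff)
  fix t assume "t \<in> J"
  have "tangential S (geo S X u t) ((- curv S) *\<^sub>R geo S X u t) = 0"
    using form_geo[OF assms(1-3), of t]
    by (cases S) (simp_all add: tangential_def form_linear del: form.simps)
  then show "\<exists>a. (geo_velocity S X u has_vector_derivative a) (at t within J) \<and>
      tangential S (geo S X u t) a = 0"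
    using geo_velocity_deriv by blast
qed (rule geo_deriv)

text \<open>The acceleration is a multiple of the position; differentiating the constants
  \<open>form S \<gamma> v = 0\<close> and \<open>form S v v = 1\<close> determines the factor as
  \<open>- curv S\<close>. The geodesic equation thus becomes linear.\<close>

lemma geodesic_unique:
  assumes "0 < \<tau>" "geodesic_on S {0..\<tau>} \<gamma>"
    and "vector_derivative \<gamma> (at 0 within {0..\<tau>}) = u" "form S u u = 1"
  shows "\<And>t. t \<in> {0..\<tau>} \<Longrightarrow> \<gamma> t = geo S (\<gamma> 0) u t"
    and "vector_derivative \<gamma> (at \<tau> within {0..\<tau>}) = geo_velocity S (\<gamma> 0) u \<tau>"
proof -
  let ?J = "{0..\<tau>}"
  obtain v where v: "\<And>t. t \<in> ?J \<Longrightarrow> (\<gamma> has_vector_derivative v t) (at t within ?J)"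
    and ex: "\<forall>t\<in>?J. \<exists>a. (v has_vector_derivative a) (at t within ?J) \<and> tangential S (\<gamma> t) a = 0"
    and pt: "\<And>t. t \<in> ?J \<Longrightarrow> \<gamma> t \<in> points S"
    using assms(2) unfolding geodesic_on_def by blast
  obtain a where a: "\<And>t. t \<in> ?J \<Longrightarrow> (v has_vector_derivative a t) (at t within ?J)"
    "\<And>t. t \<in> ?J \<Longrightarrow> tangential S (\<gamma> t) (a t) = 0"
    using bchoice[OF ex] by blast
  have vd: "vector_derivative \<gamma> (at t within ?J) = v t" if "t \<in> ?J" for t
    using vector_derivative_within_cbox[of 0 \<tau> t \<gamma> "v t"] v[OF that] that assms(1) by simp
  have v0: "v 0 = u" using vd[of 0] assms by simp
  have \<gamma>\<gamma>: "form S (\<gamma> t) (\<gamma> t) = curv S" if "t \<in> ?J" for t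
    using pt[OF that] by (simp add: points_iff)
  have const: "d = 0" if "(f has_real_derivative d) (at t within ?J)" "\<And>x. x \<in> ?J \<Longrightarrow> f x = c" "t \<in> ?J"
    for f c d t
  proof -
    have "(f has_vector_derivative 0) (at t within ?J)"
      by (rule has_vector_derivative_transform[OF that(3,2)]) simp_all
    moreover have "(f has_vector_derivative d) (at t within ?J)"
      using that(1) by (simp add: has_real_derivative_iff_has_vector_derivative)
    ultimately show ?thesis
      using vector_derivative_unique_within_closed_interval[of 0 \<tau> t f d 0] assms(1) that(3) by simp
  qed
  have \<gamma>v: "form S (\<gamma> t) (v t) = 0" if "t \<in> ?J" for t
    using const[OF has_real_derivative_form[OF v[OF that] v[OF that]] \<gamma>\<gamma> that]
    by (simp add: form_commute[of S "v t"])
  have a_eq: "a t = (curv S * form S (\<gamma> t) (a t)) *\<^sub>R \<gamma> t" if "t \<in> ?J" for t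
    using a(2)[OF that] \<gamma>\<gamma>[OF that] by (cases S) (simp_all add: tangential_def)
  have va: "form S (v t) (a t) = 0" if "t \<in> ?J" for t
    by (subst a_eq[OF that]) (simp add: form_linear form_commute[of S "v t" "\<gamma> t"] \<gamma>v[OF that])
  have "\<exists>c. \<forall>t\<in>?J. form S (v t) (v t) = c"
  proof (rule has_field_derivative_zero_constant)
    show "((\<lambda>t. form S (v t) (v t)) has_real_derivative 0) (at t within ?J)" if "t \<in> ?J" for t
      using has_real_derivative_form[OF a(1)[OF that] a(1)[OF that], of S]
      by (simp add: va[OF that] form_commute[of S "a t"])
  qed simp
  then have vv: "form S (v t) (v t) = 1" if "t \<in> ?J" for t
    using that v0 assms(1,4) by (metis atLeastAtMost_iff less_imp_le order_refl)
  have "form S (\<gamma> t) (a t) = - 1" if "t \<in> ?J" for t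
    using const[OF has_real_derivative_form[OF v[OF that] a(1)[OF that]] \<gamma>v that]
    by (simp add: vv[OF that])
  then have a_eq: "a t = (- curv S) *\<^sub>R \<gamma> t" if "t \<in> ?J" for t
    using a_eq[OF that] that by simp
  \<comment> \<open>the flow of the geodesic equation, run backwards, is constant along the solution\<close>
  define P where "P t = Cs S t *\<^sub>R \<gamma> t - Sn S t *\<^sub>R v t" for t
  define Q where "Q t = (curv S * Sn S t) *\<^sub>R \<gamma> t + Cs S t *\<^sub>R v t" for t
  have "(P has_vector_derivative 0) (at t within ?J)" if "t \<in> ?J" for t
    unfolding P_def
    by (rule derivative_eq_intros has_vector_derivative_scaleR Cs_deriv Sn_deriv v[OF that] a(1)[OF that] refl)+
      (simp add: a_eq[OF that])
  then obtain p where p: "\<And>t. t \<in> ?J \<Longrightarrow> P t = p"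
    using has_vector_derivative_zero_constant[of ?J P] by blast
  have "(Q has_vector_derivative 0) (at t within ?J)" if "t \<in> ?J" for t
    unfolding Q_def
    by (rule derivative_eq_intros has_vector_derivative_scaleR DERIV_cmult Cs_deriv Sn_deriv v[OF that]
        a(1)[OF that] refl)+ (simp add: a_eq[OF that] algebra_simps)
  then obtain q where q: "\<And>t. t \<in> ?J \<Longrightarrow> Q t = q"
    using has_vector_derivative_zero_constant[of ?J Q] by blast
  have "p = \<gamma> 0" "q = u"
    using p[of 0] q[of 0] assms(1) v0 by (simp_all add: P_def Q_def)
  then have PQ: "P t = \<gamma> 0" "Q t = u" if "t \<in> ?J" for t using p q that by auto
  show \<gamma>: "\<gamma> t = geo S (\<gamma> 0) u t" if "t \<in> ?J" for t
  proof -
    have "geo S (P t) (Q t) t = (Cs S t * Cs S t + curv S * (Sn S t * Sn S t)) *\<^sub>R \<gamma> t"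
      by (simp add: geo_def P_def Q_def algebra_simps)
    then show ?thesis unfolding Cs_Sn_pythagoras PQ[OF that] by simp
  qed
  have "v \<tau> = (Cs S \<tau> * Cs S \<tau> + curv S * (Sn S \<tau> * Sn S \<tau>)) *\<^sub>R v \<tau>"
    by (simp add: Cs_Sn_pythagoras)
  also have "\<dots> = geo_velocity S (P \<tau>) (Q \<tau>) \<tau>"
    by (simp add: geo_velocity_def P_def Q_def algebra_simps)
  finally show "vector_derivative \<gamma> (at \<tau> within ?J) = geo_velocity S (\<gamma> 0) u \<tau>"
    using vd[of \<tau>] PQ[of \<tau>] assms(1) by simp
qed

lemma Sn_pos:
  assumes "0 < t" "S = Hemisphere \<Longrightarrow> t < pi"
  shows "0 < Sn S t"
  using assms by (cases S) (auto simp: Sn_def intro: sin_gt_zero)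

lemma form_hyperbolic_neg:
  assumes "X \<in> points Hyperbolic_Plane" "Y \<in> points Hyperbolic_Plane"
  shows "form Hyperbolic_Plane X Y < 0"
proof -
  have X: "(X $ 3)\<^sup>2 = 1 + (X $ 1)\<^sup>2 + (X $ 2)\<^sup>2" "0 < X $ 3"
    and Y: "(Y $ 3)\<^sup>2 = 1 + (Y $ 1)\<^sup>2 + (Y $ 2)\<^sup>2" "0 < Y $ 3"
    using assms by (auto simp: points_iff form_eq power2_eq_square simp del: points.simps)
  have "(X $ 1 * Y $ 1 + X $ 2 * Y $ 2)\<^sup>2 \<le> ((X $ 1)\<^sup>2 + (X $ 2)\<^sup>2) * ((Y $ 1)\<^sup>2 + (Y $ 2)\<^sup>2)"
    using zero_le_power2[of "X $ 1 * Y $ 2 - X $ 2 * Y $ 1"]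
    by (simp add: power2_eq_square algebra_simps)
  also have "\<dots> < (X $ 3)\<^sup>2 * (Y $ 3)\<^sup>2"
    unfolding X(1) Y(1)
    using zero_le_power2[of "X $ 1"] zero_le_power2[of "X $ 2"] zero_le_power2[of "Y $ 1"]
      zero_le_power2[of "Y $ 2"] by (simp add: algebra_simps add_pos_nonneg)
  finally have "(X $ 1 * Y $ 1 + X $ 2 * Y $ 2)\<^sup>2 < (X $ 3 * Y $ 3)\<^sup>2"
    by (simp add: power_mult_distrib)
  then have "X $ 1 * Y $ 1 + X $ 2 * Y $ 2 < X $ 3 * Y $ 3"
    by (rule power2_less_imp_less) (use X(2) Y(2) in \<open>simp add: less_imp_le\<close>)
  then show ?thesis by (simp add: form_eq)
qed

text \<open>\<open>arccos\<close> or \<open>arsinh\<close> supplies the length; in the hyperbolic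
  case \<open>0 < c\<close> selects the branch on which \<open>cosh\<close> takes its
  values.\<close>

lemma exists_length:
  assumes "0 < r" "c\<^sup>2 + curv S * r\<^sup>2 = 1" "S = Hyperbolic_Plane \<Longrightarrow> 0 < c"
  obtains \<tau> where "0 < \<tau>" "S = Hemisphere \<longrightarrow> \<tau> < pi" "Sn S \<tau> = r" "Cs S \<tau> = c"
proof (cases S)
  case Hemisphere
  have "0 < r\<^sup>2" using assms(1) by simp
  moreover have "c\<^sup>2 + r\<^sup>2 = 1" using assms(2) Hemisphere by simp
  ultimately have c: "c\<^sup>2 < 1" by linarith
  then have c': "- 1 < c" "c < 1" using abs_square_less_1[of c] by auto
  have "sqrt (1 - c\<^sup>2) = r"
    using assms Hemisphere by (intro real_sqrt_unique) auto
  then show ?thesis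
    using that[of "arccos c"] c' Hemisphere arccos_lt_bounded[of c]
    by (simp add: Sn_def Cs_def sin_arccos)
next
  case Hyperbolic_Plane
  have "sqrt (r\<^sup>2 + 1) = c"
    using assms Hyperbolic_Plane by (intro real_sqrt_unique) auto
  then show ?thesis
    using that[of "arsinh r"] assms(1) Hyperbolic_Plane
    by (simp add: Sn_def Cs_def cosh_arsinh_real)
qed

context oval_curve
begin

definition direction :: "real \<Rightarrow> real \<Rightarrow> real ^ 3" where
  "direction s \<psi> = cos \<psi> *\<^sub>R V s + sin \<psi> *\<^sub>R N s"

lemma form_N: "form S (N s) Y = det3 (\<Gamma> s) (V s) Y"
  by (simp add: unit_normal_eq form_normal)

lemma frame_N: "form S (\<Gamma> s) (N s) = 0" "form S (V s) (N s) = 0" "form S (N s) (N s) = 1"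
proof -
  show "form S (\<Gamma> s) (N s) = 0" "form S (V s) (N s) = 0"
    by (simp_all add: form_commute[of S "\<Gamma> s"] form_commute[of S "V s"] form_N)
  show "form S (N s) (N s) = 1"
    unfolding unit_normal_eq by (rule frame_expansion(2)[OF frame])
qed

lemma form_direction:
  "form S (\<Gamma> s) (direction s \<psi>) = 0" "form S (V s) (direction s \<psi>) = cos \<psi>"
  "form S (direction s \<psi>) (direction s \<psi>) = 1" "det3 (\<Gamma> s) (V s) (direction s \<psi>) = sin \<psi>"
  by (simp_all add: direction_def form_linear frame frame_N form_commute[of S "N s" "V s"]
      form_N[symmetric] sin_cos_squared_add3)

text \<open>\<open>Sn S \<tau>\<close> and \<open>\<psi>\<close> are polar coordinates of
  \<open>\<Gamma> t\<close> in the tangent plane at \<open>\<Gamma> s\<close>. Reflection keeps the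
  tangential component, and the incoming velocity is opposite to the direction back to
  \<open>\<Gamma> s\<close>, whence \<open>pi - \<alpha> t s\<close>.\<close>

lemma geo_direction:
  assumes "geo S (\<Gamma> s) (direction s \<psi>) \<tau> = \<Gamma> t" "0 < Sn S \<tau>"
  shows "g s t = Sn S \<tau> * sin \<psi>" "h s t = Sn S \<tau> * cos \<psi>"
    and "\<Gamma> s \<noteq> \<Gamma> t \<Longrightarrow>
      arccos (form S (V t) (reflect S \<Gamma> t (geo_velocity S (\<Gamma> s) (direction s \<psi>) \<tau>))) = pi - \<alpha> t s"
proof -
  let ?w = "geo_velocity S (\<Gamma> s) (direction s \<psi>) \<tau>"
  show g: "g s t = Sn S \<tau> * sin \<psi>" and h: "h s t = Sn S \<tau> * cos \<psi>"
    by (simp_all add: g_def h_def assms(1)[symmetric] geo_def det3_linear form_linear form_direction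
        form_commute[of S "V s" "\<Gamma> s"] frame)
  assume neq: "\<Gamma> s \<noteq> \<Gamma> t"
  have "R2 s t = (Sn S \<tau>)\<^sup>2 * ((sin \<psi>)\<^sup>2 + (cos \<psi>)\<^sup>2)"
    unfolding R2_def g h power_mult_distrib by (rule distrib_left[symmetric])
  then have "R2 s t = (Sn S \<tau>)\<^sup>2" by simp
  then have "sqrt (R2 t s) = Sn S \<tau>" using assms(2) by (simp add: R2_commute[of t s])
  moreover have "h t s = form S (V t) (Cs S \<tau> *\<^sub>R \<Gamma> t - Sn S \<tau> *\<^sub>R ?w)"
    using geo_reverse[of "\<Gamma> s" S \<tau> "direction s \<psi>"] by (simp add: h_def assms(1))
  then have "h t s = - Sn S \<tau> * form S (V t) ?w"
    by (simp add: form_linear form_commute[of S "V t" "\<Gamma> t"] frame)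
  ultimately have "form S (V t) ?w = - cos (\<alpha> t s)"
    using cos_\<alpha>[OF neq[symmetric]] assms(2) by (simp add: field_simps)
  moreover have "form S (V t) (reflect S \<Gamma> t ?w) = form S (V t) ?w"
    by (simp add: reflect_def form_linear frame_N)
  ultimately show "arccos (form S (V t) (reflect S \<Gamma> t ?w)) = pi - \<alpha> t s"
    using arccos_cos[of "pi - \<alpha> t s"] \<alpha>_bounds[of t s] by simp
qed

lemma billiard_step_imp_bounce:
  assumes "billiard_step S \<Gamma> (s, \<psi>) (t, \<phi>)" "0 < \<psi>" "\<psi> < pi"
  shows "bounce (s, \<psi>) (t, \<phi>)"
proof -
  obtain \<tau> \<gamma> where \<tau>: "0 < \<tau>" and geod: "geodesic_on S {0..\<tau>} \<gamma>" and \<gamma>0: "\<gamma> 0 = \<Gamma> s"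
    and dir: "vector_derivative \<gamma> (at 0 within {0..\<tau>}) = direction s \<psi>"
    and \<gamma>\<tau>: "\<gamma> \<tau> = \<Gamma> t"
    and \<phi>: "\<phi> = arccos (form S (V t) (reflect S \<Gamma> t (vector_derivative \<gamma> (at \<tau> within {0..\<tau>}))))"
    using assms(1) unfolding billiard_step_def prod.case direction_def[symmetric] by blast
  note uniq = geodesic_unique[OF \<tau> geod dir form_direction(3), unfolded \<gamma>0]
  \<comment> \<open>At time \<open>pi\<close> a great circle reaches the antipode of its start,
    outside the open hemisphere.\<close>
  have "\<tau> < pi" if "S = Hemisphere"
  proof (rule ccontr)
    assume "\<not> \<tau> < pi"
    then have "\<gamma> pi = - \<Gamma> s"
      using uniq(1)[of pi] that by (simp add: geo_def Cs_def Sn_def)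
    moreover have "\<gamma> pi \<in> points S"
      using geod \<open>\<not> \<tau> < pi\<close> by (auto simp: geodesic_on_def)
    ultimately show False using \<Gamma>_3[of s] by (simp add: points_iff)
  qed
  then have pos: "0 < Sn S \<tau>" using \<tau> by (intro Sn_pos)
  have end_eq: "geo S (\<Gamma> s) (direction s \<psi>) \<tau> = \<Gamma> t" using uniq(1)[of \<tau>] \<tau> \<gamma>\<tau> by simp
  note gd = geo_direction[OF end_eq pos]
  have "0 < g s t" using gd(1) pos assms(2,3) by (simp add: sin_gt_zero)
  then have neq: "\<Gamma> s \<noteq> \<Gamma> t" by (auto simp: g_def)
  have "\<alpha> s t = \<psi>"
    by (rule \<alpha>_eqI[OF neq assms(2,3)]) (simp add: gd)
  moreover have "\<phi> = pi - \<alpha> t s" using \<phi> uniq(2) gd(3)[OF neq] by simp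
  ultimately show ?thesis using neq by (simp add: bounce_def)
qed

lemma bounce_imp_billiard_step:
  assumes "bounce (s, \<psi>) (t, \<phi>)"
  shows "billiard_step S \<Gamma> (s, \<psi>) (t, \<phi>)"
proof -
  have neq: "\<Gamma> s \<noteq> \<Gamma> t" and \<psi>: "\<psi> = \<alpha> s t" and \<phi>: "\<phi> = pi - \<alpha> t s"
    using assms by (auto simp: bounce_def)
  \<comment> \<open>\<open>c\<close> and \<open>r\<close> are the values that \<open>Cs S\<close>
    and \<open>Sn S\<close> must take at the length of the chord.\<close>
  define c where "c = curv S * form S (\<Gamma> s) (\<Gamma> t)"
  define r where "r = sqrt (R2 s t)"
  define u where "u = direction s \<psi>"
  have r: "0 < r" using R2_pos[OF neq] by (simp add: r_def)
  have r2: "r\<^sup>2 = R2 s t" using R2_pos[OF neq] by (simp add: r_def)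
  have "curv S * (form S (\<Gamma> s) (\<Gamma> t))\<^sup>2 + R2 s t = curv S"
    using frame_pythagoras[OF frame[of s], of "\<Gamma> t"] by (simp add: form_\<Gamma>\<Gamma> R2_def g_def h_def)
  then have "curv S * (curv S * (form S (\<Gamma> s) (\<Gamma> t))\<^sup>2 + r\<^sup>2) = curv S * curv S"
    by (simp add: r2)
  then have c1: "c\<^sup>2 + curv S * r\<^sup>2 = 1"
    by (simp add: c_def power_mult_distrib power2_eq_square algebra_simps)
  have "0 < c" if "S = Hyperbolic_Plane"
    using form_hyperbolic_neg[of "\<Gamma> s" "\<Gamma> t"] range_\<Gamma>[of s] range_\<Gamma>[of t] that
    by (simp add: c_def del: form.simps points.simps)
  then obtain \<tau> where \<tau>: "0 < \<tau>" "S = Hemisphere \<longrightarrow> \<tau> < pi" "Sn S \<tau> = r" "Cs S \<tau> = c"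
    using exists_length[OF r c1] by blast
  have "g s t = r * sin \<psi>" "h s t = r * cos \<psi>"
    using sin_\<alpha>[OF neq] cos_\<alpha>[OF neq] r by (simp_all add: \<psi> r_def)
  then have end_eq: "geo S (\<Gamma> s) u \<tau> = \<Gamma> t"
    using frame_expansion(1)[OF frame[of s], of "\<Gamma> t"]
    by (simp add: geo_def \<tau> c_def u_def direction_def unit_normal_eq g_def h_def scaleR_add_right add.assoc)
  \<comment> \<open>Spherical, respectively hyperbolic, interpolation between the endpoints; the
    coefficients are positive inside the chord, as \<open>chord_in_region\<close> asks.\<close>
  have interp: "geo S (\<Gamma> s) u x = (Sn S (\<tau> - x) / r) *\<^sub>R \<Gamma> s + (Sn S x / r) *\<^sub>R \<Gamma> t" for x
  proof -
    have "r *\<^sub>R geo S (\<Gamma> s) u x = Sn S (\<tau> - x) *\<^sub>R \<Gamma> s + Sn S x *\<^sub>R \<Gamma> t"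
      unfolding end_eq[symmetric] by (simp add: geo_def Sn_diff \<tau> algebra_simps)
    then have "(1 / r) *\<^sub>R r *\<^sub>R geo S (\<Gamma> s) u x = (1 / r) *\<^sub>R (Sn S (\<tau> - x) *\<^sub>R \<Gamma> s + Sn S x *\<^sub>R \<Gamma> t)"
      by simp
    then show ?thesis using r by (simp add: scaleR_add_right)
  qed
  have Sn: "0 < Sn S x" "0 < Sn S (\<tau> - x)" if "0 < x" "x < \<tau>" for x
    using that \<tau>(2) by (auto intro!: Sn_pos)
  have pos: "0 < geo S (\<Gamma> s) u x $ 3" if x: "x \<in> {0..\<tau>}" for x
  proof -
    consider "x = 0" | "x = \<tau>" | "0 < x" "x < \<tau>" using x by fastforce
    then show ?thesis
    proof cases
      case 3
      then show ?thesis unfolding interp using Sn[OF 3] r \<Gamma>_3[of s] \<Gamma>_3[of t] by (simp add: add_pos_pos)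
    qed (use \<Gamma>_3 end_eq in auto)
  qed
  have geod: "geodesic_on S {0..\<tau>} (geo S (\<Gamma> s) u)"
    unfolding u_def by (rule geodesic_on_geo) (use pos in \<open>auto simp: frame form_direction u_def\<close>)
  have region: "geo S (\<Gamma> s) u x \<in> region S \<Gamma>" if x: "x \<in> {0<..<\<tau>}" for x
    unfolding interp
  proof (rule chord_in_region[OF neq])
    show "0 < Sn S (\<tau> - x) / r" "0 < Sn S x / r" using Sn[of x] x r by auto
    show "(Sn S (\<tau> - x) / r) *\<^sub>R \<Gamma> s + (Sn S x / r) *\<^sub>R \<Gamma> t \<in> points S"
      using geod x unfolding interp[symmetric] by (auto simp: geodesic_on_def)
  qed
  have vd: "vector_derivative (geo S (\<Gamma> s) u) (at x within {0..\<tau>}) = geo_velocity S (\<Gamma> s) u x"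
    if "x \<in> {0..\<tau>}" for x
    using vector_derivative_within_cbox[of 0 \<tau> x _ "geo_velocity S (\<Gamma> s) u x"] geo_deriv that \<tau>(1)
    by simp
  have "\<phi> = arccos (form S (V t) (reflect S \<Gamma> t (geo_velocity S (\<Gamma> s) u \<tau>)))"
    using geo_direction(3)[OF end_eq[unfolded u_def] _ neq] r \<tau>(3) \<phi> by (simp add: u_def)
  then show ?thesis
    unfolding billiard_step_def prod.case
    using \<tau>(1) geod region end_eq vd[of 0] vd[of \<tau>]
    by (intro exI[of _ \<tau>] conjI exI[of _ "geo S (\<Gamma> s) u"]) (auto simp: u_def direction_def)
qed

lemma billiard_step_iff:
  assumes "p \<in> cylinder l" "q \<in> cylinder l"
  shows "billiard_step S \<Gamma> p q \<longleftrightarrow> q = cyl_proj l (next_bounce p)"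
proof -
  have "billiard_step S \<Gamma> p q \<longleftrightarrow> bounce p q"
    using billiard_step_imp_bounce bounce_imp_billiard_step assms
    by (cases p, cases q) (auto simp: cylinder_def)
  then show ?thesis using bounce_cyl_iff[OF assms] by simp
qed

end

section \<open>The billiard map\<close>

text \<open>The substitution rule is for absolutely integrable functions, such as this bounded one
  on a bounded interval. \<open>J\<close> is any Borel set because it will be a period with one
  point removed.\<close>

lemma nn_integral_substitution_sin:
  fixes B :: "real set" and \<beta> d :: "real \<Rightarrow> real"
  assumes B: "B \<in> sets borel" and J: "J \<in> sets borel"
    and d: "\<And>t. t \<in> J \<Longrightarrow> (\<beta> has_real_derivative d t) (at t within J)"
    and inj: "inj_on \<beta> J" and img: "\<beta> ` J = {0<..<pi}"
  shows "(\<integral>\<^sup>+\<psi>. ennreal (indicator B \<psi> * sin \<psi>) * indicator {0<..<pi} \<psi> \<partial>lborel) =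
    (\<integral>\<^sup>+t. ennreal (\<bar>d t\<bar> * (indicator B (\<beta> t) * sin (\<beta> t))) * indicator J t \<partial>lborel)"
proof -
  let ?f = "\<lambda>\<psi>. indicator B \<psi> * sin \<psi> :: real"
  have sin: "0 \<le> sin \<psi>" if "\<psi> \<in> {0<..<pi}" for \<psi>
    using that by (auto intro: sin_ge_zero)
  have "?f \<in> borel_measurable borel" using B by measurable
  then have f: "?f \<in> borel_measurable (lebesgue_on {0<..<pi})"
    by (intro measurable_restrict_space1 measurable_completion) simp
  have fint: "?f absolutely_integrable_on {0<..<pi}"
  proof (rule measurable_bounded_by_integrable_imp_absolutely_integrable[OF f])
    show "(\<lambda>x. 1 :: real) integrable_on {0<..<pi}"
      unfolding integrable_on_open_interval_real by (rule integrable_const_ivl)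
    show "norm (?f x) \<le> 1" if "x \<in> {0<..<pi}" for x
      by (simp add: indicator_def)
  qed simp
  have J': "J \<in> sets lebesgue" using J by simp
  define b where "b = integral {0<..<pi} ?f"
  have "(\<lambda>t. \<bar>d t\<bar> * ?f (\<beta> t)) absolutely_integrable_on J \<and> integral J (\<lambda>t. \<bar>d t\<bar> * ?f (\<beta> t)) = b"
    using has_absolute_integral_change_of_variables_1'[OF J' d inj, of ?f b] fint
    by (simp add: img b_def)
  then have "((\<lambda>t. \<bar>d t\<bar> * ?f (\<beta> t)) has_integral b) J"
    using set_lebesgue_integral_eq_integral(1) by (auto simp: has_integral_iff)
  moreover have "(?f has_integral b) {0<..<pi}"
    using set_lebesgue_integral_eq_integral(1)[OF fint] by (simp add: has_integral_iff b_def)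
  moreover have "0 \<le> sin (\<beta> t)" if "t \<in> J" for t
    using sin[of "\<beta> t"] img that by blast
  ultimately show ?thesis
    by (subst (1 2) nn_integral_has_integral_lebesgue') (use sin in auto)
qed

lemma borel_measurable_rmod [measurable]: "(\<lambda>x. x rmod c) \<in> borel_measurable borel"
  unfolding rmod_def by measurable

context oval_curve
begin

abbreviation "T \<equiv> billiard_map S l \<Gamma>"

lemma T_lift: "z \<in> strip \<Longrightarrow> T (cyl_proj l z) = cyl_proj l (next_bounce z)"
proof -
  assume z: "z \<in> strip"
  let ?q = "cyl_proj l (next_bounce z)"
  have p: "cyl_proj l z \<in> cylinder l" and q: "?q \<in> cylinder l"
    using z cyl_proj_in next_bounce_strip by blast+
  have *: "billiard_step S \<Gamma> (cyl_proj l z) r \<longleftrightarrow> r = ?q" if "r \<in> cylinder l" for r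
    using billiard_step_iff[OF p that] bounce_cyl_iff[OF p that] bounce_iff[OF z that] by simp
  show "T (cyl_proj l z) = ?q"
    unfolding billiard_map_def by (rule the_equality) (use q * in auto)
qed

lemma T_eq: "p \<in> cylinder l \<Longrightarrow> T p = cyl_proj l (next_bounce p)"
  using T_lift[OF cylinder_strip] by (simp add: cyl_proj_id)

lemma T_in: "p \<in> cylinder l \<Longrightarrow> T p \<in> cylinder l"
  by (simp add: T_eq cyl_proj_in next_bounce_strip cylinder_strip)

lemma bounce_T: "p \<in> cylinder l \<Longrightarrow> q \<in> cylinder l \<Longrightarrow> bounce p q \<longleftrightarrow> q = T p"
  by (simp add: bounce_cyl_iff T_eq)

lemma unique_step:
  assumes "p \<in> cylinder l"
  shows "\<exists>!q. q \<in> cylinder l \<and> billiard_step S \<Gamma> p q"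
  by (rule ex1I[of _ "T p"]) (use billiard_step_iff[OF assms] T_in[OF assms] in \<open>auto simp: T_eq[OF assms]\<close>)

text \<open>The bounce from \<open>p\<close> to \<open>T p\<close>, reversed, starts at
  \<open>angle_reversal (T p)\<close>, and a bounce is determined by its start.\<close>

lemma T_reversal: "p \<in> cylinder l \<Longrightarrow> T (angle_reversal (T p)) = angle_reversal p"
  using bounce_T[of p "T p"] bounce_reverse[of p "T p"] T_in[of p] angle_reversal_cylinder[of "T p"]
    angle_reversal_cylinder[of p] bounce_T[of "angle_reversal (T p)" "angle_reversal p"]
  by simp

lemma T_bij: "bij_betw T (cylinder l) (cylinder l)"
proof (rule bij_betw_byWitness[where f' = "\<lambda>p. angle_reversal (T (angle_reversal p))"])
  show "\<forall>p\<in>cylinder l. angle_reversal (T (angle_reversal (T p))) = p"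
    by (simp add: T_reversal)
  show "\<forall>p\<in>cylinder l. T (angle_reversal (T (angle_reversal p))) = p"
    using T_reversal[OF angle_reversal_cylinder] by simp
  show "T ` cylinder l \<subseteq> cylinder l" using T_in by blast
  show "(\<lambda>p. angle_reversal (T (angle_reversal p))) ` cylinder l \<subseteq> cylinder l"
    by (intro image_subsetI angle_reversal_cylinder T_in)
qed

lemma T_inverse:
  assumes "p \<in> cylinder l"
  shows "inv_into (cylinder l) T p = angle_reversal (T (angle_reversal p))"
proof (rule inv_into_f_eq)
  show "inj_on T (cylinder l)" using T_bij by (rule bij_betw_imp_inj_on)
  show "T (angle_reversal (T (angle_reversal p))) = p"
    using T_reversal[OF angle_reversal_cylinder[OF assms]] by simp
qed (use assms in \<open>intro T_in angle_reversal_cylinder\<close>)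

lemma T_reversible: "reversible l T"
  unfolding reversible_def using T_bij T_inverse by simp

lemma T_twist: "twist l T"
  unfolding twist_def
proof (intro ballI, clarify)
  fix s\<^sub>0 \<psi>\<^sub>0 assume p: "(s\<^sub>0, \<psi>\<^sub>0) \<in> cylinder l"
  then have s: "0 \<le> s\<^sub>0" "s\<^sub>0 < l" and \<psi>: "0 < \<psi>\<^sub>0" "\<psi>\<^sub>0 < pi" by (auto simp: cylinder_def)
  let ?t = "\<sigma> s\<^sub>0 \<psi>\<^sub>0"
  let ?D = "g ?t s\<^sub>0 / R2 s\<^sub>0 ?t"
  have neq: "\<Gamma> s\<^sub>0 \<noteq> \<Gamma> ?t" using \<sigma>[OF \<psi>, of s\<^sub>0] by (intro \<Gamma>_neq) auto
  have D: "0 < ?D" using g_pos[OF neq[symmetric]] R2_pos[OF neq] by simp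
  have "continuous_on strip (\<lambda>z. \<sigma> (fst z) (snd z))" using Ck_on_imp_continuous_on[OF Ck_\<sigma>] .
  then have "continuous_on {0<..<pi} (\<lambda>\<psi>. \<sigma> (fst (s\<^sub>0, \<psi>)) (snd (s\<^sub>0, \<psi>)))"
    by (rule continuous_on_compose2) (auto simp: strip_def intro!: continuous_intros)
  then have "isCont (\<sigma> s\<^sub>0) \<psi>\<^sub>0"
    using \<psi> by (simp add: continuous_on_eq_continuous_at)
  then have "(\<sigma> s\<^sub>0 has_real_derivative inverse ?D) (at \<psi>\<^sub>0)"
    using D \<psi> by (intro DERIV_inverse_function[where f = "\<alpha> s\<^sub>0" and a = 0 and b = pi] \<alpha>_deriv[OF neq] \<sigma>) auto
  moreover have "\<forall>\<^sub>F \<psi> in nhds \<psi>\<^sub>0. \<sigma> s\<^sub>0 \<psi> rmod l = fst (T (s\<^sub>0, \<psi>))"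
  proof (rule eventually_nhds[THEN iffD2], intro exI[of _ "{0<..<pi}"] conjI ballI)
    fix \<psi> assume "\<psi> \<in> {0<..<pi}"
    then have "(s\<^sub>0, \<psi>) \<in> cylinder l" using s by (simp add: cylinder_def)
    then show "\<sigma> s\<^sub>0 \<psi> rmod l = fst (T (s\<^sub>0, \<psi>))"
      by (simp add: T_eq next_bounce_def cyl_proj_def)
  qed (use \<psi> in auto)
  ultimately show "\<exists>\<sigma>' d. (\<forall>\<^sub>F \<psi> in nhds \<psi>\<^sub>0. \<sigma>' \<psi> rmod l = fst (T (s\<^sub>0, \<psi>))) \<and>
      (\<sigma>' has_real_derivative d) (at \<psi>\<^sub>0) \<and> 0 < d"
    using D by (metis positive_imp_inverse_positive)
qed

section \<open>Smoothness on the cylinder\<close>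

lemma Ck_angle_reversal: "Ck_on k strip angle_reversal"
proof -
  have "Ck_on k strip (\<lambda>z. (fst z, pi - snd z))"
    by (rule Ck_on_Pair[OF open_strip Ck_on_bounded_linear[OF open_strip bounded_linear_fst]
          Ck_on_diff[OF open_strip Ck_on_const[OF open_strip]
            Ck_on_bounded_linear[OF open_strip bounded_linear_snd]]])
  then show ?thesis by (simp add: angle_reversal_def case_prod_unfold)
qed

lemma cyl_CkI:
  assumes "Ck_on k strip F" "\<And>z. z \<in> strip \<Longrightarrow> F z \<in> strip"
    "\<And>z. z \<in> strip \<Longrightarrow> cyl_proj l (F z) = f (cyl_proj l z)"
  shows "cyl_Ck k l f"
  unfolding cyl_Ck_def
proof (intro conjI ballI funcsetI)
  fix p assume p: "p \<in> cylinder l"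
  then have "f p = cyl_proj l (F p)"
    using assms(3)[OF cylinder_strip] by (simp add: cyl_proj_id)
  then show "f p \<in> cylinder l"
    using assms(2)[OF cylinder_strip[OF p]] by (simp add: cyl_proj_in)
next
  fix p assume "p \<in> strip"
  then show "\<exists>U F. open U \<and> p \<in> U \<and> U \<subseteq> strip \<and> Ck_on k U F \<and>
      (\<forall>q\<in>U. F q \<in> strip \<and> cyl_proj l (F q) = f (cyl_proj l q))"
    by (intro exI[of _ strip] exI[of _ F]) (simp add: open_strip assms)
qed

lemma T_diffeomorphism: "cyl_diffeomorphism (j - 1) l T"
  unfolding cyl_diffeomorphism_def
proof (intro conjI T_bij)
  show "cyl_Ck (j - 1) l T"
    by (rule cyl_CkI[OF Ck_next_bounce next_bounce_strip]) (simp_all add: T_lift)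
  let ?F = "\<lambda>z. angle_reversal (next_bounce (angle_reversal z))"
  have in_strip: "angle_reversal ` strip \<subseteq> strip" "next_bounce ` strip \<subseteq> strip"
    using angle_reversal_strip next_bounce_strip by auto
  have 1: "Ck_on (j - 1) strip (\<lambda>z. next_bounce (angle_reversal z))"
    by (rule Ck_on_compose[OF open_strip open_strip Ck_angle_reversal Ck_next_bounce in_strip(1)])
  have "(\<lambda>z. next_bounce (angle_reversal z)) ` strip \<subseteq> strip"
    using in_strip by blast
  from Ck_on_compose[OF open_strip open_strip 1 Ck_angle_reversal this]
  show "cyl_Ck (j - 1) l (inv_into (cylinder l) T)"
  proof (rule cyl_CkI)
    fix z assume z: "z \<in> strip"
    then show "?F z \<in> strip" by (simp add: angle_reversal_strip next_bounce_strip)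
    show "cyl_proj l (?F z) = inv_into (cylinder l) T (cyl_proj l z)"
      using z by (simp add: T_inverse cyl_proj_in angle_reversal_cyl_proj T_lift angle_reversal_strip)
  qed
qed

section \<open>Invariance of the measure\<close>

lemma borel_cylinder [measurable]: "cylinder l \<in> sets borel"
proof -
  have "{0..<l} \<times> {0<..<pi} \<in> sets (borel \<Otimes>\<^sub>M borel)"
    by (intro pair_measureI) auto
  then show ?thesis unfolding cylinder_def borel_prod .
qed

lemma sets_cyl_measure: "sets (cyl_measure l) = sets (restrict_space borel (cylinder l))"
  by (simp add: cyl_measure_def sets_restrict_space)

lemma space_cyl_measure [simp]: "space (cyl_measure l) = cylinder l"
  by (simp add: cyl_measure_def space_restrict_space)

lemma sets_cyl_measure_iff: "M \<in> sets (cyl_measure l) \<longleftrightarrow> M \<in> sets borel \<and> M \<subseteq> cylinder l"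
  unfolding sets_cyl_measure using borel_cylinder by (subst sets_restrict_space_iff) auto

text \<open>\<open>T\<close> jumps where the reduction modulo \<open>l\<close> does, so
  measurability comes from the continuous lift followed by the Borel map
  \<open>cyl_proj l\<close>.\<close>

lemma T_measurable: "T \<in> measurable (cyl_measure l) (cyl_measure l)"
proof -
  have "continuous_on strip next_bounce" using Ck_on_imp_continuous_on[OF Ck_next_bounce] .
  then have "continuous_on (cylinder l) next_bounce"
    by (rule continuous_on_subset) (auto intro: cylinder_strip)
  then have 1: "next_bounce \<in> borel_measurable (restrict_space borel (cylinder l))"
    by (rule borel_measurable_continuous_on_restrict)
  have "cyl_proj l \<in> borel_measurable (borel \<Otimes>\<^sub>M borel)"
    unfolding cyl_proj_def borel_prod[symmetric] by measurable
  then have "cyl_proj l \<in> borel_measurable borel" by (simp add: borel_prod)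
  then have "(\<lambda>p. cyl_proj l (next_bounce p)) \<in> borel_measurable (restrict_space borel (cylinder l))"
    using 1 by (rule measurable_compose_rev)
  then have "T \<in> borel_measurable (restrict_space borel (cylinder l))"
    by (subst measurable_cong[where g = "\<lambda>p. cyl_proj l (next_bounce p)"])
      (auto simp: space_restrict_space T_eq)
  then have "T \<in> measurable (restrict_space borel (cylinder l)) (restrict_space borel (cylinder l))"
    by (intro measurable_restrict_space2) (auto simp: space_restrict_space T_in)
  then show ?thesis
    by (subst measurable_cong_sets[OF sets_cyl_measure sets_cyl_measure])
qed

text \<open>The density of the invariant measure in the coordinates \<open>(s, t)\<close>, the parameters of two
  consecutive points; conservation is its symmetry.\<close>

definition K :: "real \<Rightarrow> real \<Rightarrow> real" where
  "K s t = g s t * g t s / (R2 s t * sqrt (R2 s t))"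

definition E :: "(real \<times> real) set" where
  "E = {(s, t). s \<in> {0..<l} \<and> t \<in> {0..<l} \<and> s \<noteq> t}"

lemma K_commute: "K s t = K t s"
  by (simp add: K_def R2_commute[of t s])

lemma E_commute: "(s, t) \<in> E \<longleftrightarrow> (t, s) \<in> E"
  by (auto simp: E_def)

lemma E_neq: "(s, t) \<in> E \<Longrightarrow> \<Gamma> s \<noteq> \<Gamma> t"
  using \<Gamma>_eq_iff by (auto simp: E_def)

lemma T_\<alpha>: "(s, t) \<in> E \<Longrightarrow> T (s, \<alpha> s t) = (t, pi - \<alpha> t s)"
proof -
  assume st: "(s, t) \<in> E"
  have "bounce (s, \<alpha> s t) (t, pi - \<alpha> t s)" using E_neq[OF st] by (simp add: bounce_def)
  then show ?thesis
    using bounce_T[of "(s, \<alpha> s t)" "(t, pi - \<alpha> t s)"] st \<alpha>_bounds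
    by (auto simp: cylinder_def E_def)
qed

text \<open>As \<open>t\<close> passes \<open>s\<close> inside the window,
  \<open>\<alpha> s t\<close> jumps from near \<open>pi\<close> to near 0, so monotonicity does not
  apply directly; injectivity and surjectivity are read off the bounces of \<open>T\<close>.\<close>

lemma \<alpha>_fibre:
  assumes "s \<in> {0..<l}"
  shows "inj_on (\<alpha> s) ({0..<l} - {s})" "\<alpha> s ` ({0..<l} - {s}) = {0<..<pi}"
proof -
  show "inj_on (\<alpha> s) ({0..<l} - {s})"
  proof (rule inj_onI)
    fix t t' assume t: "t \<in> {0..<l} - {s}" "t' \<in> {0..<l} - {s}" "\<alpha> s t = \<alpha> s t'"
    then have E: "(s, t) \<in> E" "(s, t') \<in> E" using assms by (auto simp: E_def)
    show "t = t'" using T_\<alpha>[OF E(1)] T_\<alpha>[OF E(2)] unfolding t(3) by (metis prod.inject)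
  qed
  show "\<alpha> s ` ({0..<l} - {s}) = {0<..<pi}"
  proof
    show "\<alpha> s ` ({0..<l} - {s}) \<subseteq> {0<..<pi}" using \<alpha>_bounds by auto
    show "{0<..<pi} \<subseteq> \<alpha> s ` ({0..<l} - {s})"
    proof
      fix \<psi> assume "\<psi> \<in> {0<..<pi}"
      then have p: "(s, \<psi>) \<in> cylinder l" using assms by (simp add: cylinder_def)
      obtain t \<phi> where q: "T (s, \<psi>) = (t, \<phi>)" by (cases "T (s, \<psi>)")
      have "bounce (s, \<psi>) (t, \<phi>)" "(t, \<phi>) \<in> cylinder l"
        using bounce_T[OF p T_in[OF p]] T_in[OF p] q by auto
      then have "\<alpha> s t = \<psi>" "t \<in> {0..<l} - {s}" by (auto simp: bounce_def cylinder_def)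
      then show "\<psi> \<in> \<alpha> s ` ({0..<l} - {s})" by blast
    qed
  qed
qed

lemma measurable_gh [measurable]:
  "(\<lambda>z. g (fst z) (snd z)) \<in> borel_measurable (borel \<Otimes>\<^sub>M borel)"
  "(\<lambda>z. h (fst z) (snd z)) \<in> borel_measurable (borel \<Otimes>\<^sub>M borel)"
  unfolding borel_prod by (intro borel_measurable_continuous_onI Ck_gh)+

lemma measurable_g [measurable (raw)]:
  assumes "f1 \<in> borel_measurable M" "f2 \<in> borel_measurable M"
  shows "(\<lambda>x. g (f1 x) (f2 x)) \<in> borel_measurable M" "(\<lambda>x. h (f1 x) (f2 x)) \<in> borel_measurable M"
  using measurable_compose[OF measurable_Pair[OF assms] measurable_gh(1)]
    measurable_compose[OF measurable_Pair[OF assms] measurable_gh(2)] by simp_all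

lemma measurable_\<alpha> [measurable (raw)]:
  assumes [measurable]: "f1 \<in> borel_measurable M" "f2 \<in> borel_measurable M"
  shows "(\<lambda>x. \<alpha> (f1 x) (f2 x)) \<in> borel_measurable M"
  unfolding \<alpha>_def by measurable

lemma measurable_K [measurable (raw)]:
  assumes [measurable]: "f1 \<in> borel_measurable M" "f2 \<in> borel_measurable M"
  shows "(\<lambda>x. K (f1 x) (f2 x)) \<in> borel_measurable M"
  unfolding K_def R2_def by measurable

lemma E_measurable [measurable]: "E \<in> sets (borel \<Otimes>\<^sub>M borel)"
proof -
  have "E = {z \<in> space (borel \<Otimes>\<^sub>M borel). fst z \<in> {0..<l} \<and> snd z \<in> {0..<l} \<and> fst z \<noteq> snd z}"
    by (auto simp: E_def space_pair_measure)
  also have "\<dots> \<in> sets (borel \<Otimes>\<^sub>M borel)" by measurable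
  finally show ?thesis .
qed

text \<open>Both choices of \<open>\<beta>\<close> map the fibre onto the same interval, with the
  same sine and the same absolute derivative.\<close>

lemma emeasure_fibre:
  assumes B: "B \<in> sets borel" and s: "s \<in> {0..<l}"
    and \<beta>: "\<beta> = \<alpha> s \<or> \<beta> = (\<lambda>t. pi - \<alpha> s t)"
  shows "(\<integral>\<^sup>+\<psi>. ennreal (indicator B \<psi> * sin \<psi>) * indicator {0<..<pi} \<psi> \<partial>lborel) =
    (\<integral>\<^sup>+t. ennreal (indicator B (\<beta> t) * K s t) * indicator E (s, t) \<partial>lborel)"
proof -
  let ?J = "{0..<l} - {s}"
  define d where "d t = (if \<beta> = \<alpha> s then g t s / R2 s t else - (g t s / R2 s t))" for t
  have neq: "\<Gamma> s \<noteq> \<Gamma> t" if "t \<in> ?J" for t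
    using that s by (intro E_neq) (auto simp: E_def)
  have reflect: "(\<lambda>x. pi - x) ` {0<..<pi} = {0<..<pi}"
  proof
    show "{0<..<pi} \<subseteq> (\<lambda>x. pi - x) ` {0<..<pi}"
    proof
      fix x :: real assume "x \<in> {0<..<pi}"
      then show "x \<in> (\<lambda>x. pi - x) ` {0<..<pi}" by (intro image_eqI[of _ _ "pi - x"]) auto
    qed
  qed auto
  have "(\<integral>\<^sup>+\<psi>. ennreal (indicator B \<psi> * sin \<psi>) * indicator {0<..<pi} \<psi> \<partial>lborel) =
    (\<integral>\<^sup>+t. ennreal (\<bar>d t\<bar> * (indicator B (\<beta> t) * sin (\<beta> t))) * indicator ?J t \<partial>lborel)"
  proof (rule nn_integral_substitution_sin[OF B])
    show "(\<beta> has_real_derivative d t) (at t within ?J)" if "t \<in> ?J" for t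
    proof (cases "\<beta> = \<alpha> s")
      case True
      then show ?thesis using \<alpha>_deriv[OF neq[OF that]] by (simp add: d_def)
    next
      case False
      then have "\<beta> = (\<lambda>t. pi - \<alpha> s t)" using \<beta> by blast
      then show ?thesis
        using DERIV_diff[OF DERIV_const[of pi] \<alpha>_deriv[OF neq[OF that]]] False by (simp add: d_def)
    qed
    show "inj_on \<beta> ?J"
    proof (rule inj_onI)
      fix t t' assume t: "t \<in> ?J" "t' \<in> ?J" "\<beta> t = \<beta> t'"
      have "\<alpha> s t = \<alpha> s t'" using \<beta> t(3) by (elim disjE) simp_all
      then show "t = t'" using t(1,2) by (rule inj_onD[OF \<alpha>_fibre(1)[OF s]])
    qed
    show "\<beta> ` ?J = {0<..<pi}"
    proof (cases "\<beta> = \<alpha> s")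
      case True
      then show ?thesis using \<alpha>_fibre(2)[OF s] by simp
    next
      case False
      then have "\<beta> ` ?J = (\<lambda>x. pi - x) ` \<alpha> s ` ?J" using \<beta> by (simp add: image_image)
      then show ?thesis unfolding \<alpha>_fibre(2)[OF s] reflect .
    qed
  qed simp
  also have "\<dots> = (\<integral>\<^sup>+t. ennreal (indicator B (\<beta> t) * K s t) * indicator E (s, t) \<partial>lborel)"
  proof (rule nn_integral_cong)
    fix t
    show "ennreal (\<bar>d t\<bar> * (indicator B (\<beta> t) * sin (\<beta> t))) * indicator ?J t =
      ennreal (indicator B (\<beta> t) * K s t) * indicator E (s, t)"
    proof (cases "t \<in> ?J")
      case True
      have "sin (\<beta> t) = g s t / sqrt (R2 s t)" using \<beta> sin_\<alpha>[OF neq[OF True]] by auto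
      moreover have "\<bar>d t\<bar> = g t s / R2 s t"
        using g_pos[OF neq[OF True, symmetric]] R2_pos[OF neq[OF True]] by (simp add: d_def)
      ultimately have "\<bar>d t\<bar> * sin (\<beta> t) = K s t" by (simp add: K_def)
      then have "\<bar>d t\<bar> * (indicator B (\<beta> t) * sin (\<beta> t)) = indicator B (\<beta> t) * K s t"
        by (simp add: mult.left_commute del: mult_cancel_left)
      moreover have "(s, t) \<in> E" using True s by (auto simp: E_def)
      ultimately show ?thesis using True by (simp only: indicator_simps)
    next
      case False
      then have "(s, t) \<notin> E" by (auto simp: E_def)
      then show ?thesis using False by simp
    qed
  qed
  finally show ?thesis .
qed

text \<open>Since \<open>T\<close> sends \<open>(s, \<alpha> s t)\<close> to
  \<open>(t, pi - \<alpha> t s)\<close>, the first choice of \<open>\<beta>\<close> serves for the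
  preimage of a set under \<open>T\<close> and the second for the set itself.\<close>

lemma emeasure_cyl_measure:
  assumes M: "M \<in> sets (cyl_measure l)"
    and \<beta>: "\<beta> = \<alpha> \<or> \<beta> = (\<lambda>s t. pi - \<alpha> s t)"
  shows "emeasure (cyl_measure l) M =
    (\<integral>\<^sup>+s. \<integral>\<^sup>+t. ennreal (indicator M (s, \<beta> s t) * K s t) * indicator E (s, t) \<partial>lborel \<partial>lborel)"
proof -
  have Mb: "M \<in> sets borel" and Mc: "M \<subseteq> cylinder l" using M by (auto simp: sets_cyl_measure_iff)
  have Mp[measurable]: "M \<in> sets (borel \<Otimes>\<^sub>M borel)" unfolding borel_prod by (rule Mb)
  let ?\<rho> = "\<lambda>(s::real, \<psi>). ennreal (sin \<psi>)"
  have \<rho>p: "?\<rho> \<in> borel_measurable (borel \<Otimes>\<^sub>M borel)" by measurable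
  then have \<rho>: "?\<rho> \<in> borel_measurable lborel" by (simp add: borel_prod)
  have "emeasure (cyl_measure l) M = (\<integral>\<^sup>+z. ?\<rho> z * indicator M z \<partial>restrict_space lborel (cylinder l))"
    unfolding cyl_measure_def
  proof (rule emeasure_density)
    show "?\<rho> \<in> borel_measurable (restrict_space lborel (cylinder l))"
      using \<rho> by (rule measurable_restrict_space1)
    show "M \<in> sets (restrict_space lborel (cylinder l))"
      using M by (simp add: cyl_measure_def)
  qed
  also have "\<dots> = (\<integral>\<^sup>+z. ?\<rho> z * indicator M z * indicator (cylinder l) z \<partial>lborel)"
    by (rule nn_integral_restrict_space) simp
  also have "\<dots> = (\<integral>\<^sup>+z. ?\<rho> z * indicator M z \<partial>(lborel \<Otimes>\<^sub>M lborel))"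
    unfolding lborel_prod using Mc by (intro nn_integral_cong) (auto simp: indicator_def)
  also have "\<dots> = (\<integral>\<^sup>+s. \<integral>\<^sup>+\<psi>. ?\<rho> (s, \<psi>) * indicator M (s, \<psi>) \<partial>lborel \<partial>lborel)"
    by (rule lborel.nn_integral_fst[symmetric]) measurable
  also have "\<dots> = (\<integral>\<^sup>+s. \<integral>\<^sup>+t. ennreal (indicator M (s, \<beta> s t) * K s t) * indicator E (s, t) \<partial>lborel \<partial>lborel)"
  proof (rule nn_integral_cong)
    fix s :: real
    define B where "B = Pair s -` M"
    have B: "B \<in> sets borel" unfolding B_def using Mp by (rule sets_Pair1)
    have "(\<integral>\<^sup>+\<psi>. ?\<rho> (s, \<psi>) * indicator M (s, \<psi>) \<partial>lborel) =
      (\<integral>\<^sup>+\<psi>. ennreal (indicator B \<psi> * sin \<psi>) * indicator {0<..<pi} \<psi> \<partial>lborel)"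
      using Mc by (intro nn_integral_cong) (auto simp: indicator_def B_def cylinder_def)
    also have "\<dots> = (\<integral>\<^sup>+t. ennreal (indicator M (s, \<beta> s t) * K s t) * indicator E (s, t) \<partial>lborel)"
    proof (cases "s \<in> {0..<l}")
      case True
      have "\<beta> s = \<alpha> s \<or> \<beta> s = (\<lambda>t. pi - \<alpha> s t)" using \<beta> by auto
      from emeasure_fibre[OF B True this] show ?thesis
        by (simp add: B_def indicator_def)
    next
      case False
      then have "B = {}" "\<And>t. (s, t) \<notin> E" using Mc by (auto simp: B_def E_def cylinder_def)
      then show ?thesis by simp
    qed
    finally show "(\<integral>\<^sup>+\<psi>. ?\<rho> (s, \<psi>) * indicator M (s, \<psi>) \<partial>lborel) =
      (\<integral>\<^sup>+t. ennreal (indicator M (s, \<beta> s t) * K s t) * indicator E (s, t) \<partial>lborel)" .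
  qed
  finally show ?thesis .
qed

lemma T_conservative: "conservative l T"
  unfolding conservative_def
proof (intro conjI T_measurable measure_eqI)
  fix M assume "M \<in> sets (distr (cyl_measure l) (cyl_measure l) T)"
  then have M: "M \<in> sets (cyl_measure l)" by simp
  let ?M' = "T -` M \<inter> cylinder l"
  have M': "?M' \<in> sets (cyl_measure l)"
    using measurable_sets[OF T_measurable M] by simp
  have [measurable]: "M \<in> sets (borel \<Otimes>\<^sub>M borel)"
    using M unfolding borel_prod sets_cyl_measure_iff by blast
  have "emeasure (distr (cyl_measure l) (cyl_measure l) T) M = emeasure (cyl_measure l) ?M'"
    using emeasure_distr[OF T_measurable M] by simp
  also have "\<dots> = (\<integral>\<^sup>+s. \<integral>\<^sup>+t. ennreal (indicator ?M' (s, \<alpha> s t) * K s t) * indicator E (s, t) \<partial>lborel \<partial>lborel)"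
    by (rule emeasure_cyl_measure[OF M']) simp
  also have "\<dots> = (\<integral>\<^sup>+s. \<integral>\<^sup>+t. ennreal (indicator M (t, pi - \<alpha> t s) * K t s) * indicator E (t, s) \<partial>lborel \<partial>lborel)"
  proof (intro nn_integral_cong)
    fix s t
    show "ennreal (indicator ?M' (s, \<alpha> s t) * K s t) * indicator E (s, t) =
      ennreal (indicator M (t, pi - \<alpha> t s) * K t s) * indicator E (t, s)"
    proof (cases "(s, t) \<in> E")
      case True
      then have "(s, \<alpha> s t) \<in> cylinder l" using \<alpha>_bounds by (auto simp: E_def cylinder_def)
      then have "indicator ?M' (s, \<alpha> s t) = (indicator M (t, pi - \<alpha> t s) :: real)"
        using T_\<alpha>[OF True] by (simp add: indicator_def)
      then show ?thesis using True E_commute[of s t] by (simp add: K_commute[of s t])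
    next
      case False
      then show ?thesis using E_commute[of s t] by simp
    qed
  qed
  \<comment> \<open>Exchanging the integrals makes \<open>t\<close> the outer variable; the result
    is the formula for \<open>M\<close> with the second choice of \<open>\<beta>\<close>.\<close>
  also have "\<dots> = (\<integral>\<^sup>+t. \<integral>\<^sup>+s. ennreal (indicator M (t, pi - \<alpha> t s) * K t s) * indicator E (t, s) \<partial>lborel \<partial>lborel)"
    by (rule lborel_pair.Fubini') measurable
  also have "\<dots> = emeasure (cyl_measure l) M"
    by (rule emeasure_cyl_measure[OF M, symmetric]) simp
  finally show "emeasure (distr (cyl_measure l) (cyl_measure l) T) M = emeasure (cyl_measure l) M" .
qed simp

end

text \<open>The first conjunct certifies that the definite description in
  \<open>billiard_map\<close> denotes the intended point.\<close>

theorem theorem1: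
  fixes S :: surface and j :: nat and l :: real and \<Gamma> :: "real \<Rightarrow> real ^ 3"
  assumes "2 \<le> j"
    and "oval S j l \<Gamma>"
  shows "(\<forall>p\<in>cylinder l. \<exists>!q. q \<in> cylinder l \<and> billiard_step S \<Gamma> p q) \<and>
    reversible l (billiard_map S l \<Gamma>) \<and>
    conservative l (billiard_map S l \<Gamma>) \<and>
    twist l (billiard_map S l \<Gamma>) \<and>
    cyl_diffeomorphism (j - 1) l (billiard_map S l \<Gamma>)"
proof -
  interpret oval_curve S j l \<Gamma> using assms by unfold_locales
  show ?thesis
    using unique_step T_reversible T_conservative T_twist T_diffeomorphism by blast
qed

end
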